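(* Let $k$ be a field, let $Q$ be a finite connected quiver, and let $A=kQ/\langle Z\rangle$ be a finite-dimensional monomial algebra. Then $$\dim_k \mathrm{Alt}(DA)=\begin{cases}\frac{r-s}{2} & \text{if } \mathrm{char}\, k\neq 2,\\[2pt] \frac{r+s}{2} & \text{if } \mathrm{char}\, k=2,\end{cases}$$ where $r$ is the number of neat equivalence classes and $s$ is the number of symmetric ones, i.e. of neat equivalence classes that are stable under the flip $(\alpha,\beta)\mapsto(\beta,\alpha)$.
   Context: Quiver: vertices $Q_0$, arrows $Q_1$, source and terminal maps $s,t$. A path of length $l\ge 1$ is a sequence $a_l\cdots a_1$ of arrows with $t(a_i)=s(a_{i+1})$; its first arrow is $a_1$, its last arrow is $a_l$, its source is $s(a_1)$, its terminal vertex is $t(a_l)$. Vertices are the (trivial) paths of length $0$. The product in $kQ$ is concatenation. $Z$ is a set of paths of length at least two, minimal for the subpath order (no strict subpath of an element of $Z$ is in $Z$), and $A=kQ/\langle Z\rangle$. $B$ is the set of paths (including vertices) containing no path of $Z$ as a subpath; it is identified with a $k$-basis of $A$. $DA=\mathrm{Hom}_k(A,k)$ is the dual $A$-$A$-bimodule, $(afb)(x)=f(bxa)$. For $\varphi\in\mathrm{Hom}_{A-A}(DA,A)$ (bimodule morphisms), $\varphi^*:DA\to DDA\cong A$ is the transpose. $\mathrm{Alt}(DA)=\{\varphi\in \mathrm{Hom}_{A-A}(DA,A):\varphi+\varphi^*=0\}$. $B\odot B=\{(\alpha,\beta)\in B\times B: t(\beta)=s(\alpha),\ t(\alpha)=s(\beta)\}$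 is the set of cyclic pairs. A cyclic pair $(\alpha,\beta)\in B\odot B$ is neat if for all arrows $a,b\in Q_1$: (i) if $\beta a\in B$ then $a$ is the last arrow of $\alpha$, and if $a\beta\in B$ then $a$ is the first arrow of $\alpha$; (ii) if $\alpha b\in B$ then $b$ is the last arrow of $\beta$, and if $b\alpha\in B$ then $b$ is the first arrow of $\beta$. (Here "$\beta a\in B$" includes that $\beta a$ is a path.) Let $\sim$ be the equivalence relation on $B\odot B$ generated by $(a\alpha,\beta)\sim(\alpha,\beta a)$ and $(\alpha b,\beta)\sim(\alpha,b\beta)$ with $a,b\in Q_1$ (both pairs in $B\odot B$). An equivalence class is neat if all its elements are neat cyclic pairs. *)

theory Defs
  imports
    Complex_Main
    "HOL-Algebra.QuotRing"
    "Graph_Theory.Digraph_Component"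
    "Jordan_Normal_Form.VS_Connect"
begin

hide_const (open) Multiset.mult Polynomial.smult

section \<open>Paths in a quiver\<close>

text \<open>
  A quiver is a \<^typ>\<open>('v, 'e) pre_digraph\<close>, which admits loops and parallel arrows.
  The path \<open>a\<^sub>l \<dots> a\<^sub>1\<close> is stored as its source together with the list
  \<open>[a\<^sub>1, \<dots>, a\<^sub>l]\<close>, so the first arrow of the path is the head of the list; the trivial
  path at \<open>v\<close> is \<open>(v, [])\<close>.
\<close>

type_synonym ('v, 'e) qpath = "'v \<times> 'e list"

definition paths :: "('v, 'e) pre_digraph \<Rightarrow> ('v, 'e) qpath set" where
  "paths Q = {(u, p). \<exists>v. pre_digraph.awalk Q u p v}"

definition tgt :: "('v, 'e) pre_digraph \<Rightarrow> ('v, 'e) qpath \<Rightarrow> 'v" where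
  "tgt Q p = pre_digraph.awlast Q (fst p) (snd p)"

definition arrow :: "('v, 'e) pre_digraph \<Rightarrow> 'e \<Rightarrow> ('v, 'e) qpath" where
  "arrow Q a = (tail Q a, [a])"

text \<open>
  \<open>cat q p\<close> is the path \<open>qp\<close>, in which \<open>p\<close> is traversed first. It is meaningful only if
  \<open>q\<close> and \<open>p\<close> are composable; in particular, if \<open>q\<close> is trivial then \<open>cat q p\<close> is a path
  even when \<open>q\<close> sits at the wrong vertex.
\<close>

definition composable :: "('v, 'e) pre_digraph \<Rightarrow> ('v, 'e) qpath \<Rightarrow> ('v, 'e) qpath \<Rightarrow> bool" where
  "composable Q q p \<longleftrightarrow> q \<in> paths Q \<and> p \<in> paths Q \<and> tgt Q p = fst q"

definition cat :: "('v, 'e) qpath \<Rightarrow> ('v, 'e) qpath \<Rightarrow> ('v, 'e) qpath" where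
  "cat q p = (fst p, snd p @ snd q)"

definition subpath :: "('v, 'e) pre_digraph \<Rightarrow> ('v, 'e) qpath \<Rightarrow> ('v, 'e) qpath \<Rightarrow> bool" where
  "subpath Q p q \<longleftrightarrow>
     (\<exists>u v. composable Q p v \<and> composable Q u (cat p v) \<and> q = cat u (cat p v))"

definition minimal_relations :: "('v, 'e) pre_digraph \<Rightarrow> ('v, 'e) qpath set \<Rightarrow> bool" where
  "minimal_relations Q Z \<longleftrightarrow>
     Z \<subseteq> paths Q \<and> (\<forall>z\<in>Z. 2 \<le> length (snd z)) \<and>
     (\<forall>z\<in>Z. \<forall>z'\<in>Z. subpath Q z' z \<longrightarrow> z' = z)"

definition Bpaths :: "('v, 'e) pre_digraph \<Rightarrow> ('v, 'e) qpath set \<Rightarrow> ('v, 'e) qpath set" where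
  "Bpaths Q Z = {p \<in> paths Q. \<forall>z\<in>Z. \<not> subpath Q z p}"


section \<open>The monomial algebra\<close>

text \<open>
  The ground field is a type \<open>'k\<close> of class \<^class>\<open>field\<close>, seen as a ring record through
  \<^term>\<open>class_ring\<close>. Algebras over it are module records: addition, multiplication and
  scalar multiplication on a carrier.
\<close>

definition path_algebra ::
  "('v, 'e) pre_digraph \<Rightarrow> ('k::field, ('v, 'e) qpath \<Rightarrow> 'k) module" where
  "path_algebra Q =
     \<lparr>carrier = {f. finite {p. f p \<noteq> 0} \<and> {p. f p \<noteq> 0} \<subseteq> paths Q},
      mult = (\<lambda>f g p. \<Sum>(q, r)\<in>{(q, r). composable Q q r \<and> cat q r = p}. f q * g r),
      one = (\<lambda>p. if \<exists>v\<in>verts Q. p = (v, []) then 1 else 0),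
      zero = (\<lambda>p. 0),
      add = (\<lambda>f g p. f p + g p),
      smult = (\<lambda>c f p. c * f p)\<rparr>"

definition path_vector :: "('v, 'e) qpath \<Rightarrow> ('v, 'e) qpath \<Rightarrow> 'k::field" where
  "path_vector p = (\<lambda>q. if q = p then 1 else 0)"

text \<open>The library's quotient ring carries no scalar multiplication, so it is added here.\<close>

definition quotient_algebra :: "('k::field, 'b) module \<Rightarrow> 'b set \<Rightarrow> ('k, 'b set) module" where
  "quotient_algebra R I =
     ring.extend (R Quot I) (module.fields (\<lambda>c X. \<Union>x\<in>X. I +>\<^bsub>R\<^esub> (c \<odot>\<^bsub>R\<^esub> x)))"

definition monomial_algebra ::
  "('v, 'e) pre_digraph \<Rightarrow> ('v, 'e) qpath set \<Rightarrow>
     ('k::field, (('v, 'e) qpath \<Rightarrow> 'k) set) module" where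
  "monomial_algebra Q Z =
     quotient_algebra (path_algebra Q) (Idl\<^bsub>path_algebra Q\<^esub> (path_vector ` Z))"


section \<open>The dual bimodule and the space of alternating morphisms\<close>

definition ground_space :: "('k::field, 'k) module" where
  "ground_space =
     \<lparr>carrier = UNIV, mult = (*), one = 1, zero = 0, add = (+), smult = (*)\<rparr>"

text \<open>
  \<open>Hom\<^sub>k(V, W)\<close>; linear maps are taken extensional so that equality of maps is equality on
  \<^term>\<open>carrier V\<close>. The fields \<^const>\<open>mult\<close> and \<^const>\<open>one\<close> of the record play no role.
\<close>

definition hom_space ::
  "('k::field, 'a) module \<Rightarrow> ('k, 'b) module \<Rightarrow> ('k, 'a \<Rightarrow> 'b) module" where
  "hom_space V W =
     \<lparr>carrier = LinearCombinations.module_hom class_ring V W \<inter> extensional (carrier V),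
      mult = (\<lambda>f g. \<lambda>x\<in>carrier V. \<zero>\<^bsub>W\<^esub>),
      one = (\<lambda>x\<in>carrier V. \<zero>\<^bsub>W\<^esub>),
      zero = (\<lambda>x\<in>carrier V. \<zero>\<^bsub>W\<^esub>),
      add = (\<lambda>f g. \<lambda>x\<in>carrier V. f x \<oplus>\<^bsub>W\<^esub> g x),
      smult = (\<lambda>c f. \<lambda>x\<in>carrier V. c \<odot>\<^bsub>W\<^esub> f x)\<rparr>"

definition dual :: "('k::field, 'a) module \<Rightarrow> ('k, 'a \<Rightarrow> 'k) module" where
  "dual V = hom_space V ground_space"

text \<open>The element \<open>afb\<close> of \<open>DA\<close>.\<close>

definition dual_act :: "('k::field, 'a) module \<Rightarrow> 'a \<Rightarrow> ('a \<Rightarrow> 'k) \<Rightarrow> 'a \<Rightarrow> 'a \<Rightarrow> 'k" where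
  "dual_act A a f b = (\<lambda>x\<in>carrier A. f (b \<otimes>\<^bsub>A\<^esub> x \<otimes>\<^bsub>A\<^esub> a))"

definition bimodule_homs :: "('k::field, 'a) module \<Rightarrow> (('a \<Rightarrow> 'k) \<Rightarrow> 'a) set" where
  "bimodule_homs A =
     {\<phi> \<in> carrier (hom_space (dual A) A).
        \<forall>a\<in>carrier A. \<forall>b\<in>carrier A. \<forall>f\<in>carrier (dual A).
          \<phi> (dual_act A a f b) = a \<otimes>\<^bsub>A\<^esub> \<phi> f \<otimes>\<^bsub>A\<^esub> b}"

definition evaluation :: "('k::field, 'a) module \<Rightarrow> 'a \<Rightarrow> ('a \<Rightarrow> 'k) \<Rightarrow> 'k" where
  "evaluation V x = (\<lambda>f\<in>carrier (dual V). f x)"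

text \<open>
  The transpose of \<open>\<phi> : DA \<rightarrow> A\<close> is the map \<open>DA \<rightarrow> DDA\<close>, \<open>f \<mapsto> f \<circ> \<phi>\<close>, followed by the inverse of
  the evaluation isomorphism \<open>A \<rightarrow> DDA\<close>.
\<close>

definition dual_transpose ::
  "('k::field, 'a) module \<Rightarrow> (('a \<Rightarrow> 'k) \<Rightarrow> 'a) \<Rightarrow> (('a \<Rightarrow> 'k) \<Rightarrow> 'a)" where
  "dual_transpose A \<phi> =
     (\<lambda>f\<in>carrier (dual A).
        inv_into (carrier A) (evaluation A) (\<lambda>g\<in>carrier (dual A). f (\<phi> g)))"

definition Alt :: "('k::field, 'a) module \<Rightarrow> ('k, ('a \<Rightarrow> 'k) \<Rightarrow> 'a) module" where
  "Alt A =
     (hom_space (dual A) A)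
       \<lparr>carrier := {\<phi> \<in> bimodule_homs A.
          \<phi> \<oplus>\<^bsub>hom_space (dual A) A\<^esub> dual_transpose A \<phi> = \<zero>\<^bsub>hom_space (dual A) A\<^esub>}\<rparr>"


section \<open>Neat cyclic pairs\<close>

definition cyclic_pairs ::
  "('v, 'e) pre_digraph \<Rightarrow> ('v, 'e) qpath set \<Rightarrow> (('v, 'e) qpath \<times> ('v, 'e) qpath) set" where
  "cyclic_pairs Q Z =
     {(\<alpha>, \<beta>). \<alpha> \<in> Bpaths Q Z \<and> \<beta> \<in> Bpaths Q Z \<and> tgt Q \<beta> = fst \<alpha> \<and> tgt Q \<alpha> = fst \<beta>}"

definition cat_in_B ::
  "('v, 'e) pre_digraph \<Rightarrow> ('v, 'e) qpath set \<Rightarrow> ('v, 'e) qpath \<Rightarrow> ('v, 'e) qpath \<Rightarrow> bool" where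
  "cat_in_B Q Z q p \<longleftrightarrow> composable Q q p \<and> cat q p \<in> Bpaths Q Z"

definition is_first_arrow :: "'e \<Rightarrow> ('v, 'e) qpath \<Rightarrow> bool" where
  "is_first_arrow a p \<longleftrightarrow> snd p \<noteq> [] \<and> hd (snd p) = a"

definition is_last_arrow :: "'e \<Rightarrow> ('v, 'e) qpath \<Rightarrow> bool" where
  "is_last_arrow a p \<longleftrightarrow> snd p \<noteq> [] \<and> last (snd p) = a"

definition neat ::
  "('v, 'e) pre_digraph \<Rightarrow> ('v, 'e) qpath set \<Rightarrow> ('v, 'e) qpath \<times> ('v, 'e) qpath \<Rightarrow> bool" where
  "neat Q Z = (\<lambda>(\<alpha>, \<beta>).
     (\<forall>a\<in>arcs Q.
        (cat_in_B Q Z \<beta> (arrow Q a) \<longrightarrow> is_last_arrow a \<alpha>) \<and>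
        (cat_in_B Q Z (arrow Q a) \<beta> \<longrightarrow> is_first_arrow a \<alpha>)) \<and>
     (\<forall>b\<in>arcs Q.
        (cat_in_B Q Z \<alpha> (arrow Q b) \<longrightarrow> is_last_arrow b \<beta>) \<and>
        (cat_in_B Q Z (arrow Q b) \<alpha> \<longrightarrow> is_first_arrow b \<beta>)))"

inductive move ::
  "('v, 'e) pre_digraph \<Rightarrow> ('v, 'e) qpath set \<Rightarrow>
     ('v, 'e) qpath \<times> ('v, 'e) qpath \<Rightarrow> ('v, 'e) qpath \<times> ('v, 'e) qpath \<Rightarrow> bool"
  for Q Z where
  left: "a \<in> arcs Q \<Longrightarrow> composable Q (arrow Q a) \<alpha> \<Longrightarrow> composable Q \<beta> (arrow Q a) \<Longrightarrow>
     (cat (arrow Q a) \<alpha>, \<beta>) \<in> cyclic_pairs Q Z \<Longrightarrow>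
     (\<alpha>, cat \<beta> (arrow Q a)) \<in> cyclic_pairs Q Z \<Longrightarrow>
     move Q Z (cat (arrow Q a) \<alpha>, \<beta>) (\<alpha>, cat \<beta> (arrow Q a))"
| right: "b \<in> arcs Q \<Longrightarrow> composable Q \<alpha> (arrow Q b) \<Longrightarrow> composable Q (arrow Q b) \<beta> \<Longrightarrow>
     (cat \<alpha> (arrow Q b), \<beta>) \<in> cyclic_pairs Q Z \<Longrightarrow>
     (\<alpha>, cat (arrow Q b) \<beta>) \<in> cyclic_pairs Q Z \<Longrightarrow>
     move Q Z (cat \<alpha> (arrow Q b), \<beta>) (\<alpha>, cat (arrow Q b) \<beta>)"

definition cyclic_equiv ::
  "('v, 'e) pre_digraph \<Rightarrow> ('v, 'e) qpath set \<Rightarrow> (('v, 'e) qpath \<times> ('v, 'e) qpath) rel" where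
  "cyclic_equiv Q Z =
     {(x, y) \<in> cyclic_pairs Q Z \<times> cyclic_pairs Q Z. equivclp (move Q Z) x y}"

definition neat_classes ::
  "('v, 'e) pre_digraph \<Rightarrow> ('v, 'e) qpath set \<Rightarrow> (('v, 'e) qpath \<times> ('v, 'e) qpath) set set" where
  "neat_classes Q Z = {X \<in> cyclic_pairs Q Z // cyclic_equiv Q Z. \<forall>x\<in>X. neat Q Z x}"

definition symmetric_neat_classes ::
  "('v, 'e) pre_digraph \<Rightarrow> ('v, 'e) qpath set \<Rightarrow> (('v, 'e) qpath \<times> ('v, 'e) qpath) set set" where
  "symmetric_neat_classes Q Z = {X \<in> neat_classes Q Z. prod.swap ` X = X}"

end

theory Submission
  imports Defs
begin

text \<open>
  A bimodule morphism \<open>\<phi> : DA \<rightarrow> A\<close> is given by its matrix \<open>M(\<alpha>, \<beta>)\<close>, the coefficient of \<open>\<alpha>\<close> in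
  \<open>\<phi>(\<beta>\<^sup>*)\<close>, where \<open>\<beta>\<^sup>*\<close> runs through the basis dual to the paths in \<open>B\<close>. Compatibility with vertices
  says that \<open>M\<close> lives on cyclic pairs. Since \<open>a\<beta>\<^sup>* = \<gamma>\<^sup>*\<close> if \<open>\<beta> = \<gamma>a\<close> and \<open>a\<beta>\<^sup>* = 0\<close> otherwise,
  compatibility with arrows says that \<open>M\<close> is invariant under the moves generating \<open>\<sim>\<close> and vanishes on
  pairs that are not neat. So \<open>M\<close> is an arbitrary function on the neat classes. The transpose of \<open>\<phi>\<close>
  has the transposed matrix; hence \<open>\<phi>\<close> is alternating iff \<open>M(X) + M(flip X) = 0\<close> for every neat class
  \<open>X\<close>. Thus \<open>M\<close> is free on one class of each pair \<open>X \<noteq> flip X\<close>, and on a symmetric class it is zero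
  unless \<open>2 = 0\<close> in the field, in which case it is free.
\<close>

section \<open>Vector spaces in coordinates\<close>

text \<open>The spaces involved live on very different carriers: cosets of finitely supported
  functions, extensional linear maps, morphisms cut out by conditions. One device serves them all,
  an injective linear coordinate map into field-valued functions. It supplies the vector space
  axioms and, if its image consists of all functions supported on a finite index set, the dimension.
  It also yields the finiteness of B from the finite dimension of A. The main obstacle is that a
  bimodule morphism must respect all of A, whereas moves and neatness speak of single arrows.
  Linearity reduces elements of A to paths, and an induction on the length of the path reduces paths
  to arrows. At the level of matrices the right action needs no induction of its own: it is the left
  action for the transposed matrix, and moves and neatness are symmetric under the flip. Both
  characteristics share one parametrization, by an index set of neat classes that contains the
  symmetric ones exactly if 2 = 0.\<close>

locale linear_embedding =
  fixes V :: "('k::field, 'a) module" and h :: "'a \<Rightarrow> 'i \<Rightarrow> 'k"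
  assumes zero_closed: "\<zero>\<^bsub>V\<^esub> \<in> carrier V"
    and add_closed: "x \<in> carrier V \<Longrightarrow> y \<in> carrier V \<Longrightarrow> x \<oplus>\<^bsub>V\<^esub> y \<in> carrier V"
    and smult_closed: "x \<in> carrier V \<Longrightarrow> c \<odot>\<^bsub>V\<^esub> x \<in> carrier V"
    and zero: "h \<zero>\<^bsub>V\<^esub> i = 0"
    and add: "x \<in> carrier V \<Longrightarrow> y \<in> carrier V \<Longrightarrow> h (x \<oplus>\<^bsub>V\<^esub> y) i = h x i + h y i"
    and smult: "x \<in> carrier V \<Longrightarrow> h (c \<odot>\<^bsub>V\<^esub> x) i = c * h x i"
    and inj: "inj_on h (carrier V)"
begin

lemma eqI: "x \<in> carrier V \<Longrightarrow> y \<in> carrier V \<Longrightarrow> (\<And>i. h x i = h y i) \<Longrightarrow> x = y"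
  by (rule inj_onD[OF inj]) auto

lemmas closed = zero_closed add_closed smult_closed

text \<open>Each axiom holds because its two sides have the same coordinates and \<open>h\<close> is
  injective; the negative of a vector is its multiple by -1.\<close>

lemma is_vectorspace: "vectorspace class_ring V"
proof -
  have cr: "cring (class_ring :: 'k ring)"
    using class_field[where ?'a = 'k] by (simp add: field_def domain_def)
  have neg: "\<exists>y\<in>carrier V. x \<oplus>\<^bsub>V\<^esub> y = \<zero>\<^bsub>V\<^esub>" if "x \<in> carrier V" for x
    by (rule bexI[of _ "(-1) \<odot>\<^bsub>V\<^esub> x"])
      (use that in \<open>auto intro!: eqI closed simp: add smult zero closed\<close>)
  have "Module.module class_ring V"
    by (rule module_criteria[OF cr])
      (auto intro!: eqI neg simp: closed add smult zero algebra_simps)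
  then show ?thesis
    unfolding vectorspace_def using class_field by auto
qed

sublocale vectorspace class_ring V
  by (rule is_vectorspace)

lemma finsum:
  assumes "finite S" "f \<in> S \<rightarrow> carrier V"
  shows "h (\<Oplus>\<^bsub>V\<^esub>x\<in>S. f x) i = (\<Sum>x\<in>S. h (f x) i)"
  using assms
proof (induction S rule: finite_induct)
  case (insert x S)
  then have "(\<Oplus>\<^bsub>V\<^esub>x\<in>S. f x) \<in> carrier V" "f x \<in> carrier V" by auto
  with insert show ?case by (simp add: finsum_insert add Pi_def)
qed (simp add: zero)

lemma lincomb_coord:
  assumes "finite S" "S \<subseteq> carrier V"
  shows "h (lincomb a S) i = (\<Sum>x\<in>S. a x * h x i)"
proof -
  have "(\<lambda>v. a v \<odot>\<^bsub>V\<^esub> v) \<in> S \<rightarrow> carrier V"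
    using assms closed by auto
  then show ?thesis
    unfolding lincomb_def using assms by (auto simp: finsum smult intro!: sum.cong)
qed

text \<open>Reading a combination of the vectors \<open>e j\<close> at the coordinate j returns the
  coefficient of \<open>e j\<close>, so a vanishing combination has no nonzero coefficient.\<close>

lemma dual_family_independent:
  assumes "e \<in> J \<rightarrow> carrier V" and d: "\<And>i j. j \<in> J \<Longrightarrow> h (e j) i = (if i = j then 1 else 0)"
  shows "inj_on e J" "lin_indpt (e ` J)"
proof -
  show inj_e: "inj_on e J"
  proof (rule inj_onI)
    fix i j assume "i \<in> J" "j \<in> J" "e i = e j"
    then show "i = j" using d[of i i] d[of j i] by (metis zero_neq_one)
  qed
  show "lin_indpt (e ` J)"
  proof
    assume "lin_dep (e ` J)"
    then obtain S a v where S: "finite S" "S \<subseteq> e ` J" "lincomb a S = \<zero>\<^bsub>V\<^esub>" "v \<in> S" "a v \<noteq> 0"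
      unfolding lin_dep_def by auto
    then obtain j where j: "j \<in> J" "v = e j" by auto
    have "0 = h (lincomb a S) j" using S zero by simp
    also have "\<dots> = (\<Sum>x\<in>S. a x * h x j)"
      using S assms(1) by (intro lincomb_coord) auto
    also have "\<dots> = (\<Sum>x\<in>S. if x = v then a x else 0)"
    proof (rule sum.cong)
      fix x assume "x \<in> S"
      then obtain i where i: "i \<in> J" "x = e i" using S by auto
      show "a x * h x j = (if x = v then a x else 0)"
        using i j d[of i j] inj_e by (auto dest: inj_onD)
    qed simp
    also have "\<dots> = a v" using S by simp
    finally show False using S by simp
  qed
qed

text \<open>This is how finite dimension turns into finiteness of an index set: independent families
  in a finite-dimensional space are finite.\<close>

lemma finite_dual_family:
  assumes "fin_dim" "e \<in> J \<rightarrow> carrier V"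
    and "\<And>i j. j \<in> J \<Longrightarrow> h (e j) i = (if i = j then 1 else 0)"
  shows "finite J"
  using dual_family_independent[OF assms(2,3)] li_le_dim(1)[OF assms(1), of "e ` J"] assms(2)
  by (auto dest: finite_imageD)

end

text \<open>Here \<open>h\<close> is an isomorphism onto the functions supported on I. Using
  functions on the whole index type that vanish off I lets different finite sets I share one type,
  and makes \<open>vec\<close>, the inverse of \<open>h\<close>, meaningful exactly on such
  functions.\<close>

locale coordinates = linear_embedding V h
  for V :: "('k::field, 'a) module" and h :: "'a \<Rightarrow> 'i \<Rightarrow> 'k" +
  fixes I :: "'i set"
  assumes finite_index: "finite I"
    and range: "h ` carrier V = {f. \<forall>i. i \<notin> I \<longrightarrow> f i = 0}"
begin

definition vec :: "('i \<Rightarrow> 'k) \<Rightarrow> 'a" where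
  "vec f = inv_into (carrier V) h f"

definition e :: "'i \<Rightarrow> 'a" where
  "e i = vec (\<lambda>j. if j = i then 1 else 0)"

lemma outside: "x \<in> carrier V \<Longrightarrow> i \<notin> I \<Longrightarrow> h x i = 0"
  using range by auto

lemma vec:
  assumes "\<And>i. i \<notin> I \<Longrightarrow> f i = 0"
  shows "vec f \<in> carrier V" "h (vec f) = f"
proof -
  have "f \<in> h ` carrier V" unfolding range using assms by auto
  then show "vec f \<in> carrier V" "h (vec f) = f"
    unfolding vec_def by (auto intro: inv_into_into f_inv_into_f)
qed

lemma e_closed: "i \<in> I \<Longrightarrow> e i \<in> carrier V"
  and e_coord: "i \<in> I \<Longrightarrow> h (e i) j = (if j = i then 1 else 0)"
  unfolding e_def by (subst vec; auto)+

lemma basis_e: "basis (e ` I)"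
proof -
  have "x \<in> span (e ` I)" if x: "x \<in> carrier V" for x
  proof -
    let ?a = "\<lambda>v. h x (inv_into I e v)"
    have inj_e: "inj_on e I" using e_closed e_coord by (intro dual_family_independent(1)) auto
    have c: "lincomb ?a (e ` I) \<in> carrier V" using e_closed by (intro lincomb_closed) auto
    have "h (lincomb ?a (e ` I)) j = h x j" for j
    proof -
      have "h (lincomb ?a (e ` I)) j = (\<Sum>v\<in>e ` I. ?a v * h v j)"
        using finite_index e_closed by (intro lincomb_coord) auto
      also have "\<dots> = (\<Sum>i\<in>I. h x i * h (e i) j)"
        using inj_e by (simp add: sum.reindex inv_into_f_f)
      also have "\<dots> = (\<Sum>i\<in>I. if i = j then h x j else 0)"
        by (intro sum.cong) (auto simp: e_coord)
      also have "\<dots> = h x j"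
        using finite_index outside[OF x, of j] by (simp add: sum.delta)
      finally show ?thesis .
    qed
    with c x have "x = lincomb ?a (e ` I)" by (intro eqI) auto
    then show ?thesis unfolding span_def using finite_index by auto
  qed
  moreover have "span (e ` I) \<subseteq> carrier V"
    using e_closed by (intro span_is_subset2) auto
  ultimately have "span (e ` I) = carrier V" by blast
  moreover have "lin_indpt (e ` I)"
    using e_closed e_coord by (intro dual_family_independent(2)) auto
  ultimately show ?thesis
    unfolding basis_def using e_closed by auto
qed

lemma fin_dim: "fin_dim" and dim: "dim = card I"
proof -
  have "inj_on e I" using e_closed e_coord by (intro dual_family_independent(1)) auto
  then show "dim = card I"
    using dim_basis[OF _ basis_e] finite_index by (simp add: card_image)
  show "fin_dim" using basis_e finite_index unfolding basis_def fin_dim_def by blast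
qed

text \<open>The unit vectors are split off one at a time: erasing the coordinate k of x gives y with
  x = y + (h x k) e k, so that only additivity and homogeneity of \<phi> are used. The target is
  merely embedded and may have infinitely many coordinates.\<close>

lemma hom_expansion:
  assumes W: "linear_embedding W g" and \<phi>: "\<phi> \<in> LinearCombinations.module_hom class_ring V W"
    and x: "x \<in> carrier V"
  shows "g (\<phi> x) j = (\<Sum>i\<in>I. g (\<phi> (e i)) j * h x i)"
proof -
  interpret W: linear_embedding W g by (rule W)
  note hom = module_hom_closed[OF \<phi>] module_hom_add[OF \<phi>] module_hom_smult[OF \<phi>, simplified]
  have closed': "\<phi> y \<in> carrier W" if "y \<in> carrier V" for y using hom(1) that by auto
  have "g (\<phi> x) j = (\<Sum>i\<in>J. g (\<phi> (e i)) j * h x i)"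
    if "J \<subseteq> I" "finite J" "x \<in> carrier V" "\<And>i. i \<notin> J \<Longrightarrow> h x i = 0" for J x
    using that(2,1,3,4)
  proof (induction J arbitrary: x rule: finite_induct)
    case empty
    have "x = 0 \<odot>\<^bsub>V\<^esub> x" using empty by (intro eqI) (auto simp: closed smult)
    then have "g (\<phi> x) j = g (0 \<odot>\<^bsub>W\<^esub> \<phi> x) j" using hom(3)[of x 0] empty by simp
    then show ?case using empty closed' by (simp add: W.smult)
  next
    case (insert k J)
    define y where "y = vec (\<lambda>i. if i = k then 0 else h x i)"
    have y: "y \<in> carrier V" "h y = (\<lambda>i. if i = k then 0 else h x i)"
      using insert outside unfolding y_def by (subst vec; auto)+
    have k: "e k \<in> carrier V" using insert e_closed by auto
    have "x = y \<oplus>\<^bsub>V\<^esub> h x k \<odot>\<^bsub>V\<^esub> e k"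
      using insert y k by (intro eqI) (auto simp: closed add smult e_coord)
    then have "g (\<phi> x) j = g (\<phi> y) j + h x k * g (\<phi> (e k)) j"
      using y k hom(2)[of y "h x k \<odot>\<^bsub>V\<^esub> e k"] hom(3)[of "e k"]
      by (simp add: closed W.closed W.add W.smult closed')
    also have "g (\<phi> y) j = (\<Sum>i\<in>J. g (\<phi> (e i)) j * h y i)"
      using insert y by (intro insert.IH) auto
    also have "\<dots> = (\<Sum>i\<in>J. g (\<phi> (e i)) j * h x i)"
      using insert y by (intro sum.cong) auto
    finally show ?case using insert by simp
  qed
  from this[of I x] show ?thesis using finite_index x outside by auto
qed

end

section \<open>Spaces of linear maps and dual spaces in coordinates\<close>

lemma ground_space_coordinates: "coordinates ground_space (\<lambda>x (_::unit). x) UNIV"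
  by unfold_locales (auto simp: ground_space_def inj_on_def fun_eq_iff image_def)

text \<open>The entry at (j, i) is row j, column i of the matrix of \<phi>. Only i is guarded,
  because for i outside I the unit vector is an unspecified value; for j outside the index set of
  the target the entry of a linear map vanishes by itself.\<close>

definition hom_coord where
  "hom_coord V h I g = (\<lambda>\<phi> (j, i). if i \<in> I then g (\<phi> (coordinates.e V h i)) j else 0)"

lemma hom_space_simps:
  "carrier (hom_space V W) = LinearCombinations.module_hom class_ring V W \<inter> extensional (carrier V)"
  "\<zero>\<^bsub>hom_space V W\<^esub> = (\<lambda>x\<in>carrier V. \<zero>\<^bsub>W\<^esub>)"
  "f \<oplus>\<^bsub>hom_space V W\<^esub> g = (\<lambda>x\<in>carrier V. f x \<oplus>\<^bsub>W\<^esub> g x)"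
  "c \<odot>\<^bsub>hom_space V W\<^esub> f = (\<lambda>x\<in>carrier V. c \<odot>\<^bsub>W\<^esub> f x)"
  by (simp_all add: hom_space_def)

text \<open>A map is recovered from its matrix by expanding the argument along the unit vectors, and
  extensionality fixes it off the carrier. Conversely a matrix M is realized by the map that sends x
  to the vector with coordinates M x.\<close>

lemma hom_space_coordinates:
  assumes V: "coordinates V h I" and W: "coordinates W g J"
  shows "coordinates (hom_space V W) (hom_coord V h I g) (J \<times> I)"
proof -
  interpret V: coordinates V h I by (rule V)
  interpret W: coordinates W g J by (rule W)
  let ?H = "hom_space V W"
  let ?c = "hom_coord V h I g"
  have hom_closed: "\<phi> x \<in> carrier W" if "\<phi> \<in> carrier ?H" "x \<in> carrier V" for \<phi> x
    using that unfolding hom_space_simps LinearCombinations.module_hom_def by auto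
  have hom: "\<phi> (x \<oplus>\<^bsub>V\<^esub> y) = \<phi> x \<oplus>\<^bsub>W\<^esub> \<phi> y" "\<phi> (c \<odot>\<^bsub>V\<^esub> x) = c \<odot>\<^bsub>W\<^esub> \<phi> x"
    if "\<phi> \<in> carrier ?H" "x \<in> carrier V" "y \<in> carrier V" for \<phi> x y c
    using that unfolding hom_space_simps LinearCombinations.module_hom_def by auto
  have homI: "(\<lambda>x\<in>carrier V. \<phi> x) \<in> carrier ?H"
    if "\<And>x. x \<in> carrier V \<Longrightarrow> \<phi> x \<in> carrier W"
      "\<And>x y j. x \<in> carrier V \<Longrightarrow> y \<in> carrier V \<Longrightarrow> g (\<phi> (x \<oplus>\<^bsub>V\<^esub> y)) j = g (\<phi> x) j + g (\<phi> y) j"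
      "\<And>x c j. x \<in> carrier V \<Longrightarrow> g (\<phi> (c \<odot>\<^bsub>V\<^esub> x)) j = c * g (\<phi> x) j" for \<phi>
    using that unfolding hom_space_simps LinearCombinations.module_hom_def
    by (auto simp: V.closed intro!: W.eqI simp: W.closed W.add W.smult)
  show ?thesis
  proof (unfold_locales, goal_cases)
    case 1
    show ?case unfolding hom_space_simps(2)
      by (rule homI) (auto simp: W.closed W.zero)
  next
    case (2 x y)
    show ?case unfolding hom_space_simps(3)
      by (rule homI) (auto simp: 2 W.closed W.add W.smult V.closed hom hom_closed algebra_simps)
  next
    case (3 x c)
    show ?case unfolding hom_space_simps(4)
      by (rule homI) (auto simp: 3 W.closed W.add W.smult V.closed hom hom_closed algebra_simps)
  next
    case (4 i)
    then show ?case
      by (cases i) (simp add: hom_coord_def hom_space_simps V.e_closed W.zero)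
  next
    case (5 x y i)
    then show ?case
      by (cases i) (simp add: hom_coord_def hom_space_simps(3) V.e_closed W.add hom_closed)
  next
    case (6 x c i)
    then show ?case
      by (cases i) (simp add: hom_coord_def hom_space_simps(4) V.e_closed W.smult hom_closed)
  next
    case 7
    show ?case
    proof (rule inj_onI)
      fix \<phi> \<psi> assume \<phi>: "\<phi> \<in> carrier ?H" and \<psi>: "\<psi> \<in> carrier ?H" and eq: "?c \<phi> = ?c \<psi>"
      have e: "g (\<phi> (V.e i)) j = g (\<psi> (V.e i)) j" if "i \<in> I" for i j
        using fun_cong[OF eq, of "(j, i)"] that by (simp add: hom_coord_def)
      have "\<phi> x = \<psi> x" if x: "x \<in> carrier V" for x
      proof (rule W.eqI)
        show "g (\<phi> x) j = g (\<psi> x) j" for j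
          using \<phi> \<psi> x e V.hom_expansion[OF W.linear_embedding_axioms, of _ x j]
          by (simp add: hom_space_simps)
      qed (use \<phi> \<psi> x hom_closed in auto)
      then show "\<phi> = \<psi>" using \<phi> \<psi>
        by (auto simp: hom_space_simps intro: extensionalityI)
    qed
  next
    case 8
    show ?case using V.finite_index W.finite_index by auto
  next
    case 9
    have "M \<in> ?c ` carrier ?H" if M: "\<And>i. i \<notin> J \<times> I \<Longrightarrow> M i = 0" for M
    proof (rule image_eqI)
      let ?f = "\<lambda>x j. \<Sum>i\<in>I. M (j, i) * h x i"
      let ?\<phi> = "\<lambda>x\<in>carrier V. W.vec (?f x)"
      have f: "W.vec (?f x) \<in> carrier W" "g (W.vec (?f x)) = ?f x" for x
        by (subst W.vec; auto simp: M)+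
      show "?\<phi> \<in> carrier ?H"
        by (rule homI; simp only: f)
          (auto simp: V.add V.smult distrib_left sum.distrib sum_distrib_left mult.left_commute)
      show "M = ?c ?\<phi>"
      proof
        fix p
        show "M p = ?c ?\<phi> p"
        proof (cases p)
          case p: (Pair j i)
          show ?thesis
          proof (cases "i \<in> I")
            case True
            then have "?f (V.e i) j = (\<Sum>i'\<in>I. if i' = i then M (j, i) else 0)"
              by (intro sum.cong) (auto simp: V.e_coord)
            then show ?thesis using True V.finite_index V.e_closed
              by (simp add: p hom_coord_def f sum.delta)
          next
            case False
            then show ?thesis by (simp add: p hom_coord_def M)
          qed
        qed
      qed
    qed
    moreover have "?c \<phi> (j, i) = 0" if "\<phi> \<in> carrier ?H" "(j, i) \<notin> J \<times> I" for \<phi> j i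
      using that hom_closed V.e_closed W.outside by (auto simp: hom_coord_def)
    ultimately show ?case by (intro equalityI subsetI) auto
  qed
qed

definition dual_coord where
  "dual_coord V h I = (\<lambda>f i. if i \<in> I then f (coordinates.e V h i) else 0)"

text \<open>The ground field is one-dimensional with index type \<open>unit\<close>. Dropping this
  dummy row index makes the dual space indexed by I itself, and the unit vectors of the dual space
  become the dual basis.\<close>

lemma dual_coordinates:
  assumes "coordinates V h I"
  shows "coordinates (dual V) (dual_coord V h I) I"
proof -
  let ?c = "hom_coord V h I (\<lambda>x (_::unit). x)"
  interpret H: coordinates "dual V" ?c "UNIV \<times> I"
    unfolding dual_def by (rule hom_space_coordinates[OF assms ground_space_coordinates])
  interpret V: coordinates V h I by (rule assms)
  have eq: "dual_coord V h I f i = ?c f ((), i)" for f i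
    by (simp add: dual_coord_def hom_coord_def)
  show ?thesis
  proof (unfold_locales, goal_cases)
    case 7
    show ?case
      by (rule inj_onI, rule H.eqI) (auto simp: eq fun_eq_iff)
  next
    case 9
    have "f \<in> dual_coord V h I ` carrier (dual V)" if f: "\<And>i. i \<notin> I \<Longrightarrow> f i = 0" for f
    proof (rule image_eqI)
      let ?g = "\<lambda>(u::unit, i). f i"
      have "?c (H.vec ?g) = ?g" by (rule H.vec) (use f in fastforce)
      then show "f = dual_coord V h I (H.vec ?g)" by (simp add: fun_eq_iff eq)
      show "H.vec ?g \<in> carrier (dual V)" by (rule H.vec) (use f in fastforce)
    qed
    then show ?case by (auto 0 3 simp: dual_coord_def)
  qed (auto simp: eq H.closed H.zero H.add H.smult V.finite_index)
qed

section \<open>Paths and the path algebra\<close>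

context wf_digraph
begin

lemma paths_Nil [simp]: "(u, []) \<in> paths G \<longleftrightarrow> u \<in> verts G"
  by (auto simp: paths_def awalk_Nil_iff)

lemma paths_Cons [simp]:
  "(u, a # p) \<in> paths G \<longleftrightarrow> a \<in> arcs G \<and> u = tail G a \<and> (head G a, p) \<in> paths G"
  by (auto simp: paths_def awalk_Cons_iff)

lemma tgt_Nil [simp]: "tgt G (u, []) = u"
  and tgt_Cons [simp]: "tgt G (u, a # p) = tgt G (head G a, p)"
  by (simp_all add: tgt_def)

lemma tgt_append [simp]: "tgt G (u, p @ q) = tgt G (tgt G (u, p), q)"
  by (induction p arbitrary: u) auto

lemma paths_append [simp]:
  "(u, p @ q) \<in> paths G \<longleftrightarrow> (u, p) \<in> paths G \<and> (tgt G (u, p), q) \<in> paths G"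
  by (induction p arbitrary: u; cases q) (auto simp: head_in_verts)

lemma tgt_in_verts: "p \<in> paths G \<Longrightarrow> tgt G p \<in> verts G"
  using paths_append[of "fst p" "snd p" "[]"] by simp

lemma fst_in_verts: "p \<in> paths G \<Longrightarrow> fst p \<in> verts G"
  using paths_append[of "fst p" "[]" "snd p"] by simp

lemma composable_pair [simp]:
  "composable G (w, q) (u, p) \<longleftrightarrow> w = tgt G (u, p) \<and> (u, p @ q) \<in> paths G"
  by (auto simp: composable_def)

lemma cat_pair [simp]: "cat (w, q) (u, p) = (u, p @ q)"
  by (simp add: cat_def)

lemma fst_cat [simp]: "fst (cat q p) = fst p"
  by (simp add: cat_def)

lemma tgt_cat: "composable G q p \<Longrightarrow> tgt G (cat q p) = tgt G q"
  by (cases q; cases p) auto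

lemma cat_in_paths: "composable G q p \<Longrightarrow> cat q p \<in> paths G"
  by (cases q; cases p) auto

lemma cat_assoc: "cat (cat r q) p = cat r (cat q p)"
  by (simp add: cat_def)

lemma composable_cat_left:
  "composable G q p \<Longrightarrow> composable G (cat q p) r \<longleftrightarrow> composable G p r"
  by (auto simp: composable_def cat_in_paths)

lemma composable_cat_right:
  "composable G q p \<Longrightarrow> composable G r (cat q p) \<longleftrightarrow> composable G r q"
  using tgt_cat[of q p] by (auto simp: composable_def cat_in_paths)

text \<open>The multiplication of the path algebra is a convolution over these factorizations, in
  which r is traversed first. Trivial factors count, so a path of length l has l + 1 of
  them.\<close>

definition splits :: "('a, 'b) qpath \<Rightarrow> (('a, 'b) qpath \<times> ('a, 'b) qpath) set" where
  "splits p = {(q, r). composable G q r \<and> cat q r = p}"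

lemma splits_iff: "(q, r) \<in> splits p \<longleftrightarrow> composable G q r \<and> cat q r = p"
  by (simp add: splits_def)

lemma finite_splits: "finite (splits p)"
proof (rule finite_subset)
  \<comment> \<open>A factorization is determined by the length i of the factor that is traversed
    first.\<close>
  let ?f = "\<lambda>i. ((tgt G (fst p, take i (snd p)), drop i (snd p)), (fst p, take i (snd p)))"
  show "splits p \<subseteq> ?f ` {..length (snd p)}"
  proof clarify
    fix w q u r assume "((w, q), (u, r)) \<in> splits p"
    then have "((w, q), (u, r)) = ?f (length r)" "length r \<le> length (snd p)"
      by (auto simp: splits_iff)
    then show "((w, q), (u, r)) \<in> ?f ` {..length (snd p)}" by blast
  qed
qed simp

lemma splits_not_path: "p \<notin> paths G \<Longrightarrow> splits p = {}"
  using cat_in_paths by (auto simp: splits_iff)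

text \<open>Both sides run over the factorizations of p into three paths, bracketed in the two
  possible ways. This is the associativity of the convolution product.\<close>

lemma sum_splits_assoc:
  fixes F :: "_ \<Rightarrow> _ \<Rightarrow> _ \<Rightarrow> 'k::comm_monoid_add"
  shows "(\<Sum>(q, r)\<in>splits p. \<Sum>(q1, q2)\<in>splits q. F q1 q2 r) =
         (\<Sum>(q, r)\<in>splits p. \<Sum>(r1, r2)\<in>splits r. F q r1 r2)"
proof -
  have "(\<Sum>(q, r)\<in>splits p. \<Sum>(q1, q2)\<in>splits q. F q1 q2 r) =
     (\<Sum>((q, r), (q1, q2))\<in>Sigma (splits p) (\<lambda>(q, r). splits q). F q1 q2 r)"
    by (subst sum.Sigma[symmetric]) (auto simp: finite_splits split_def)
  also have "\<dots> = (\<Sum>((q, r), (r1, r2))\<in>Sigma (splits p) (\<lambda>(q, r). splits r). F q r1 r2)"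
    by (rule sum.reindex_bij_witness[of _
          "\<lambda>((q, r), (r1, r2)). ((cat q r1, r2), (q, r1))"
          "\<lambda>((q, r), (q1, q2)). ((q1, cat q2 r), (q2, r))"])
      (auto simp: splits_iff cat_assoc composable_cat_left composable_cat_right
          dest: composable_cat_left composable_cat_right)
  also have "\<dots> = (\<Sum>(q, r)\<in>splits p. \<Sum>(r1, r2)\<in>splits r. F q r1 r2)"
    by (subst sum.Sigma[symmetric]) (auto simp: finite_splits split_def)
  finally show ?thesis .
qed

section \<open>The path algebra as a ring\<close>

lemma path_algebra_simps:
  "carrier (path_algebra G) = {f. finite {p. f p \<noteq> 0} \<and> {p. f p \<noteq> 0} \<subseteq> paths G}"
  "(f \<otimes>\<^bsub>path_algebra G\<^esub> g) p = (\<Sum>(q, r)\<in>splits p. f q * g r)"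
  "\<one>\<^bsub>path_algebra G\<^esub> = (\<lambda>p. if \<exists>v\<in>verts G. p = (v, []) then 1 else 0)"
  "\<zero>\<^bsub>path_algebra G\<^esub> = (\<lambda>p. 0)"
  "f \<oplus>\<^bsub>path_algebra G\<^esub> g = (\<lambda>p. f p + g p)"
  "c \<odot>\<^bsub>path_algebra G\<^esub> f = (\<lambda>p. c * f p)"
  by (simp_all add: path_algebra_def splits_def)

text \<open>Elements of the path algebra are already functions, so the identity is the coordinate
  map. There may be infinitely many paths, so no finite index set is claimed at this point.\<close>

lemma path_algebra_embedding: "linear_embedding (path_algebra G :: ('k::field, _) module) (\<lambda>f. f)"
proof -
  let ?R = "path_algebra G :: ('k, _) module"
  have add: "f \<oplus>\<^bsub>?R\<^esub> g \<in> carrier ?R" if "f \<in> carrier ?R" "g \<in> carrier ?R" for f g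
  proof -
    have "{p. f p + g p \<noteq> 0} \<subseteq> {p. f p \<noteq> 0} \<union> {p. g p \<noteq> 0}" by auto
    with that show ?thesis
      unfolding path_algebra_simps mem_Collect_eq by (meson finite_UnI finite_subset le_sup_iff order_trans)
  qed
  have smult: "c \<odot>\<^bsub>?R\<^esub> f \<in> carrier ?R" if "f \<in> carrier ?R" for c f
  proof -
    have "{p. c * f p \<noteq> 0} \<subseteq> {p. f p \<noteq> 0}" by auto
    with that show ?thesis
      unfolding path_algebra_simps mem_Collect_eq by (meson finite_subset order_trans)
  qed
  show ?thesis
    by unfold_locales (use add smult in \<open>simp_all add: path_algebra_simps\<close>)
qed

lemma path_algebra_mult_closed:
  assumes "f \<in> carrier (path_algebra G)" "g \<in> carrier (path_algebra G)"
  shows "f \<otimes>\<^bsub>path_algebra G\<^esub> g \<in> carrier (path_algebra G)"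
proof -
  let ?m = "f \<otimes>\<^bsub>path_algebra G\<^esub> g"
  let ?S = "(\<lambda>(q, r). cat q r) ` ({p. f p \<noteq> 0} \<times> {p. g p \<noteq> 0})"
  have "p \<in> ?S \<and> p \<in> paths G" if nonzero: "?m p \<noteq> 0" for p
  proof -
    obtain q r where "(q, r) \<in> splits p" "f q * g r \<noteq> 0"
      using nonzero unfolding path_algebra_simps
      by (rule sum.not_neutral_contains_not_neutral) auto
    then show ?thesis by (force simp: splits_iff cat_in_paths)
  qed
  moreover have "finite ?S" using assms by (auto simp: path_algebra_simps)
  ultimately show ?thesis
    unfolding path_algebra_simps(1) by (auto intro: finite_subset[of _ ?S])
qed

lemma path_vector_simp [simp]: "path_vector p q = (if q = p then 1 else 0)"
  by (simp add: path_vector_def)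

lemma path_vector_closed [simp]: "p \<in> paths G \<Longrightarrow> path_vector p \<in> carrier (path_algebra G)"
  by (auto simp: path_algebra_simps)

lemma mult_path_vectors:
  assumes "composable G q r"
  shows "(c \<odot>\<^bsub>path_algebra G\<^esub> path_vector q) \<otimes>\<^bsub>path_algebra G\<^esub> path_vector r =
         c \<odot>\<^bsub>path_algebra G\<^esub> path_vector (cat q r)"
proof
  fix p
  have "(\<Sum>(q', r')\<in>splits p. (c * path_vector q q') * path_vector r r') =
        (\<Sum>x\<in>splits p. if x = (q, r) then c else 0)"
    by (intro sum.cong) (auto split: if_splits)
  also have "\<dots> = (if p = cat q r then c else 0)"
    using assms by (auto simp: sum.delta finite_splits splits_iff)
  finally show "((c \<odot>\<^bsub>path_algebra G\<^esub> path_vector q) \<otimes>\<^bsub>path_algebra G\<^esub> path_vector r) p =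
         (c \<odot>\<^bsub>path_algebra G\<^esub> path_vector (cat q r)) p"
    by (simp add: path_algebra_simps)
qed

text \<open>Exactly one factorization of p has a trivial left factor, namely the one with the vertex
  where p ends. This makes the sum of all vertices a left unit.\<close>

lemma sum_splits_trivial_left:
  fixes f :: "('a, 'b) qpath \<Rightarrow> 'k::semiring_1"
  assumes "p \<in> paths G"
  shows "(\<Sum>(q, r)\<in>splits p. (if \<exists>v\<in>verts G. q = (v, []) then 1 else 0) * f r) = f p"
proof -
  have "(\<Sum>(q, r)\<in>splits p. (if \<exists>v\<in>verts G. q = (v, []) then 1 else 0) * f r) =
        (\<Sum>x\<in>splits p. if x = ((tgt G p, []), p) then f p else 0)"
    using assms tgt_in_verts[OF assms]
    by (intro sum.cong) (auto simp: splits_iff composable_def cat_def split: if_splits)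
  also have "\<dots> = f p"
    using assms by (cases p) (auto simp: sum.delta finite_splits splits_iff tgt_in_verts)
  finally show ?thesis .
qed

lemma sum_splits_trivial_right:
  fixes f :: "('a, 'b) qpath \<Rightarrow> 'k::semiring_1"
  assumes "p \<in> paths G"
  shows "(\<Sum>(q, r)\<in>splits p. f q * (if \<exists>v\<in>verts G. r = (v, []) then 1 else 0)) = f p"
proof -
  have "(\<Sum>(q, r)\<in>splits p. f q * (if \<exists>v\<in>verts G. r = (v, []) then 1 else 0)) =
        (\<Sum>x\<in>splits p. if x = (p, (fst p, [])) then f p else 0)"
    using assms fst_in_verts[OF assms]
    by (intro sum.cong) (auto simp: splits_iff composable_def cat_def split: if_splits)
  also have "\<dots> = f p"
    using assms by (cases p) (auto simp: sum.delta finite_splits splits_iff fst_in_verts)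
  finally show ?thesis .
qed

end

text \<open>Finiteness of the vertex set makes the sum of all trivial paths an element of finite
  support; it is the unit.\<close>

lemma (in fin_digraph) path_algebra_ring: "ring (path_algebra G :: ('k::field, _) module)"
proof -
  let ?R = "path_algebra G :: ('k, _) module"
  interpret R: linear_embedding ?R "\<lambda>f. f" by (rule path_algebra_embedding)
  have outside: "f p = 0" if "f \<in> carrier ?R" "p \<notin> paths G" for f p
    using that by (auto simp: path_algebra_simps)
  have one: "\<one>\<^bsub>?R\<^esub> \<in> carrier ?R"
    using finite_verts by (auto simp: path_algebra_simps image_iff intro: finite_subset[of _ "(\<lambda>v. (v, [])) ` verts G"])
  have assoc: "(f \<otimes>\<^bsub>?R\<^esub> g) \<otimes>\<^bsub>?R\<^esub> k = f \<otimes>\<^bsub>?R\<^esub> (g \<otimes>\<^bsub>?R\<^esub> k)" for f g k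
    using sum_splits_assoc[of "\<lambda>x y z. f x * g y * k z"]
    by (auto simp: fun_eq_iff path_algebra_simps sum_distrib_left sum_distrib_right mult.assoc split_def)
  have "monoid ?R"
  proof (rule monoidI)
    fix f assume f: "f \<in> carrier ?R"
    show "\<one>\<^bsub>?R\<^esub> \<otimes>\<^bsub>?R\<^esub> f = f"
    proof
      fix p
      show "(\<one>\<^bsub>?R\<^esub> \<otimes>\<^bsub>?R\<^esub> f) p = f p"
        using sum_splits_trivial_left[of p f] outside[OF f]
        by (cases "p \<in> paths G") (auto simp: path_algebra_simps splits_not_path)
    qed
    show "f \<otimes>\<^bsub>?R\<^esub> \<one>\<^bsub>?R\<^esub> = f"
    proof
      fix p
      show "(f \<otimes>\<^bsub>?R\<^esub> \<one>\<^bsub>?R\<^esub>) p = f p"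
        using sum_splits_trivial_right[of p f] outside[OF f]
        by (cases "p \<in> paths G") (auto simp: path_algebra_simps splits_not_path)
    qed
  qed (simp_all add: one assoc path_algebra_mult_closed)
  then show ?thesis
    by (intro ringI R.abelian_group_axioms)
      (auto simp: path_algebra_simps fun_eq_iff algebra_simps sum.distrib split_def)
qed

section \<open>The path basis of a monomial algebra\<close>

locale monomial = fin_digraph Q for Q :: "('v, 'e) pre_digraph" +
  fixes Z :: "('v, 'e) qpath set"
  assumes relations: "minimal_relations Q Z"
begin

abbreviation B :: "('v, 'e) qpath set" where
  "B \<equiv> Bpaths Q Z"

lemma B_paths: "p \<in> B \<Longrightarrow> p \<in> paths Q"
  by (simp add: Bpaths_def)

lemma subpath_cat:
  assumes "composable Q q p"
  shows "subpath Q z p \<Longrightarrow> subpath Q z (cat q p)" "subpath Q z q \<Longrightarrow> subpath Q z (cat q p)"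
proof -
  assume "subpath Q z p"
  then obtain u v where uv: "composable Q z v" "composable Q u (cat z v)" "p = cat u (cat z v)"
    unfolding subpath_def by blast
  with assms show "subpath Q z (cat q p)"
    unfolding subpath_def
    by (intro exI[of _ "cat q u"] exI[of _ v])
      (auto simp: cat_assoc composable_cat_right composable_cat_left)
next
  assume "subpath Q z q"
  then obtain u v where uv: "composable Q z v" "composable Q u (cat z v)" "q = cat u (cat z v)"
    unfolding subpath_def by blast
  with assms show "subpath Q z (cat q p)"
    unfolding subpath_def
    by (intro exI[of _ u] exI[of _ "cat v p"])
      (auto simp: cat_assoc composable_cat_right composable_cat_left)
qed

lemma B_cat:
  assumes "cat q p \<in> B" "composable Q q p"
  shows "q \<in> B" "p \<in> B"
  using assms subpath_cat[OF assms(2)] by (auto simp: Bpaths_def composable_def)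

lemma B_splits: "p \<in> B \<Longrightarrow> (q, r) \<in> splits p \<Longrightarrow> q \<in> B \<and> r \<in> B"
  using B_cat[of q r] by (auto simp: splits_iff)

section \<open>The ideal of relations and the quotient by it\<close>

lemma Z_paths: "z \<in> Z \<Longrightarrow> z \<in> paths Q"
  using relations by (auto simp: minimal_relations_def)

lemma Z_not_B: "z \<in> Z \<Longrightarrow> z \<notin> B"
proof
  assume "z \<in> Z" "z \<in> B"
  then have "composable Q z (fst z, [])" "composable Q (tgt Q z, []) (cat z (fst z, []))"
    "z = cat (tgt Q z, []) (cat z (fst z, []))"
    using Z_paths[of z] fst_in_verts[of z] tgt_in_verts[of z]
    by (auto simp: composable_def cat_def)
  then have "subpath Q z z" unfolding subpath_def by metis
  with \<open>z \<in> Z\<close> \<open>z \<in> B\<close> show False by (auto simp: Bpaths_def)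
qed

text \<open>Functions vanishing on B form an ideal because every factor of a path in B is again in
  B, and this ideal contains Z. Conversely, a path outside B has the form uzv with z in Z, so it
  lies in the generated ideal, and so do the finite combinations of such paths.\<close>

lemma relation_ideal:
  "Idl\<^bsub>path_algebra Q\<^esub> (path_vector ` Z) =
    {f \<in> carrier (path_algebra Q :: ('k::field, _) module). \<forall>p\<in>B. f p = 0}"
  (is "?J = ?I")
proof -
  let ?R = "path_algebra Q :: ('k, _) module"
  interpret R: ring ?R by (rule path_algebra_ring)
  interpret E: linear_embedding ?R "\<lambda>f. f" by (rule path_algebra_embedding)
  have minus: "\<ominus>\<^bsub>?R\<^esub> f = (\<lambda>p. - f p)" if f: "f \<in> carrier ?R" for f
    by (rule R.minus_equality) (use f in \<open>auto simp: path_algebra_simps\<close>)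
  have "subgroup ?I (add_monoid ?R)"
  proof (rule R.add.subgroupI)
    show "?I \<noteq> {}" using E.zero_closed by (auto simp: path_algebra_simps)
  next
    fix f assume "f \<in> ?I"
    then show "\<ominus>\<^bsub>?R\<^esub> f \<in> ?I" using R.a_inv_closed[of f] by (simp add: minus)
  next
    fix f g assume "f \<in> ?I" "g \<in> ?I"
    then show "f \<oplus>\<^bsub>?R\<^esub> g \<in> ?I" using E.add_closed[of f g] E.add[of f g] by simp
  qed auto
  then have ideal_I: "ideal ?I ?R"
  proof (rule idealI[OF path_algebra_ring])
    fix f g assume f: "f \<in> ?I" and g: "g \<in> carrier ?R"
    have "(\<Sum>(q, r)\<in>splits p. g q * f r) = 0" "(\<Sum>(q, r)\<in>splits p. f q * g r) = 0"
      if "p \<in> B" for p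
      using f B_splits[OF that] by (auto intro!: sum.neutral)
    then show "g \<otimes>\<^bsub>?R\<^esub> f \<in> ?I" "f \<otimes>\<^bsub>?R\<^esub> g \<in> ?I"
      using f g path_algebra_mult_closed[of f g] path_algebra_mult_closed[of g f]
      by (auto simp: path_algebra_simps(2))
  qed
  have Z_sub: "path_vector ` Z \<subseteq> carrier ?R" using Z_paths by auto
  have "path_vector ` Z \<subseteq> ?I"
    using Z_sub Z_not_B by auto
  then have "?J \<subseteq> ?I" by (rule R.genideal_minimal[OF ideal_I])
  moreover have "?I \<subseteq> ?J"
  proof
    interpret J: ideal ?J ?R by (rule R.genideal_ideal[OF Z_sub])
    \<comment> \<open>The generated ideal is a ring ideal and is known to absorb ring elements only,
      so the scalar enters through the ring factor on the left: c(uzv) = ((c u) z) v.\<close>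
    have single: "c \<odot>\<^bsub>?R\<^esub> path_vector p \<in> ?J" if p: "p \<in> paths Q" "p \<notin> B" for p and c :: 'k
    proof -
      obtain z u v where z: "z \<in> Z" and uv: "composable Q z v" "composable Q u (cat z v)"
        and p_eq: "p = cat u (cat z v)"
        using p unfolding Bpaths_def subpath_def by auto
      have paths: "u \<in> paths Q" "v \<in> paths Q" "composable Q u z"
        using uv by (auto simp: composable_def tgt_cat[OF uv(1)])
      have uz: "composable Q (cat u z) v"
        using uv paths by (simp add: composable_cat_left)
      have "path_vector z \<in> ?J" using R.genideal_self[OF Z_sub] z by blast
      then have "((c \<odot>\<^bsub>?R\<^esub> path_vector u) \<otimes>\<^bsub>?R\<^esub> path_vector z) \<otimes>\<^bsub>?R\<^esub> path_vector v \<in> ?J"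
        using paths by (intro J.I_r_closed J.I_l_closed E.smult_closed) auto
      then show ?thesis
        using paths uz by (simp add: mult_path_vectors p_eq cat_assoc)
    qed
    have "f \<in> ?J" if "finite S" "S \<subseteq> paths Q - B" "f \<in> carrier ?R" "{p. f p \<noteq> 0} \<subseteq> S" for f S
      using that
    proof (induction S arbitrary: f rule: finite_induct)
      case empty
      then have "f = \<zero>\<^bsub>?R\<^esub>" by (auto simp: path_algebra_simps)
      then show ?case by (simp only: J.zero_closed)
    next
      case (insert p S)
      let ?g = "f(p := 0)"
      have "{q. ?g q \<noteq> 0} \<subseteq> {q. f q \<noteq> 0}" by auto
      with insert.prems(2) have g: "?g \<in> carrier ?R"
        unfolding path_algebra_simps mem_Collect_eq by (meson finite_subset order_trans)
      have "?g \<in> ?J" using insert.prems by (intro insert.IH g) auto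
      moreover have "f p \<odot>\<^bsub>?R\<^esub> path_vector p \<in> ?J" using insert.prems by (intro single) auto
      ultimately have "?g \<oplus>\<^bsub>?R\<^esub> f p \<odot>\<^bsub>?R\<^esub> path_vector p \<in> ?J" by (rule J.a_closed)
      also have "?g \<oplus>\<^bsub>?R\<^esub> f p \<odot>\<^bsub>?R\<^esub> path_vector p = f"
        by (auto simp: path_algebra_simps fun_eq_iff)
      finally show ?case .
    qed
    then show "f \<in> ?J" if "f \<in> ?I" for f
      using that by (auto simp: path_algebra_simps)
  qed
  ultimately show ?thesis by blast
qed

text \<open>All members of a coset agree on B, so the chosen representative does not matter there.
  The resulting function is the normal form of the class, in which all paths outside B have been
  deleted.\<close>

definition coset_coord :: "(('v, 'e) qpath \<Rightarrow> 'k) set \<Rightarrow> ('v, 'e) qpath \<Rightarrow> 'k::field" where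
  "coset_coord X p = (if p \<in> B then (SOME f. f \<in> X) p else 0)"

text \<open>Everything is computed on representatives. The image of the coordinate map is described
  through finite supports because the finiteness of B is not yet available; it is deduced from the
  first and the last of these facts once A is assumed to be finite-dimensional.\<close>

lemma monomial_algebra_facts:
  fixes A :: "('k::field, (('v, 'e) qpath \<Rightarrow> 'k) set) module"
  defines "A \<equiv> monomial_algebra Q Z"
  shows "linear_embedding A coset_coord" "monoid A"
    and "\<And>x y p. x \<in> carrier A \<Longrightarrow> y \<in> carrier A \<Longrightarrow>
      coset_coord (x \<otimes>\<^bsub>A\<^esub> y) p =
        (if p \<in> B then \<Sum>(q, r)\<in>splits p. coset_coord x q * coset_coord y r else 0)"
    and "coset_coord ` carrier A = {f. finite {p. f p \<noteq> 0} \<and> {p. f p \<noteq> 0} \<subseteq> B}"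
proof -
  let ?R = "path_algebra Q :: ('k, _) module"
  define I where "I = Idl\<^bsub>?R\<^esub> (path_vector ` Z)"
  have I: "I = {f \<in> carrier ?R. \<forall>p\<in>B. f p = 0}"
    unfolding I_def by (rule relation_ideal)
  interpret R: ring ?R by (rule path_algebra_ring)
  interpret E: linear_embedding ?R "\<lambda>f. f" by (rule path_algebra_embedding)
  interpret I: ideal I ?R unfolding I_def by (rule R.genideal_ideal) (use Z_paths in auto)
  let ?c = "\<lambda>f. I +>\<^bsub>?R\<^esub> f"
  \<comment> \<open>Two elements are congruent modulo I iff they agree on B. All later statements
    about cosets are reduced to this one.\<close>
  have coset: "g \<in> ?c f \<longleftrightarrow> g \<in> carrier ?R \<and> (\<forall>p\<in>B. g p = f p)" if f: "f \<in> carrier ?R" for f g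
  proof
    assume "g \<in> ?c f"
    then obtain i where "i \<in> I" "g = i \<oplus>\<^bsub>?R\<^esub> f" by (auto simp: a_r_coset_def')
    with f show "g \<in> carrier ?R \<and> (\<forall>p\<in>B. g p = f p)"
      using E.add_closed[of i f] unfolding I by (auto simp: path_algebra_simps(5))
  next
    assume g: "g \<in> carrier ?R \<and> (\<forall>p\<in>B. g p = f p)"
    let ?i = "g \<oplus>\<^bsub>?R\<^esub> (-1) \<odot>\<^bsub>?R\<^esub> f"
    have "?i \<in> carrier ?R" using f g E.closed by auto
    with g have "?i \<in> I" unfolding I by (auto simp: path_algebra_simps(5,6))
    moreover have "g = ?i \<oplus>\<^bsub>?R\<^esub> f" by (auto simp: path_algebra_simps(5,6))
    ultimately show "g \<in> ?c f" unfolding a_r_coset_def' by blast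
  qed
  have coset_eq: "?c f = ?c g" if "f \<in> carrier ?R" "g \<in> carrier ?R" "\<And>p. p \<in> B \<Longrightarrow> f p = g p" for f g
    using that by (auto simp: coset)
  have coord: "coset_coord (?c f) p = (if p \<in> B then f p else 0)" if f: "f \<in> carrier ?R" for f p
  proof -
    have "f \<in> ?c f" using f by (simp only: coset) simp
    then have "(SOME g. g \<in> ?c f) \<in> ?c f"
      by (rule someI[where P = "\<lambda>g. g \<in> ?c f"])
    then show ?thesis using f by (auto simp: coset coset_coord_def)
  qed
  have A_simps: "carrier A = a_rcosets\<^bsub>?R\<^esub> I" "x \<otimes>\<^bsub>A\<^esub> y = rcoset_mult ?R I x y"
    "\<one>\<^bsub>A\<^esub> = ?c \<one>\<^bsub>?R\<^esub>" "\<zero>\<^bsub>A\<^esub> = I" "x \<oplus>\<^bsub>A\<^esub> y = x <+>\<^bsub>?R\<^esub> y"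
    "c \<odot>\<^bsub>A\<^esub> x = (\<Union>f\<in>x. ?c (c \<odot>\<^bsub>?R\<^esub> f))" for x y c
    unfolding A_def monomial_algebra_def quotient_algebra_def I_def[symmetric]
    by (simp_all add: ring.defs module.defs FactRing_def)
  have carrier: "carrier A = ?c ` carrier ?R"
    unfolding A_simps A_RCOSETS_def' by auto
  have smult: "c \<odot>\<^bsub>A\<^esub> ?c f = ?c (c \<odot>\<^bsub>?R\<^esub> f)" if f: "f \<in> carrier ?R" for c f
  proof -
    have "?c (c \<odot>\<^bsub>?R\<^esub> g) = ?c (c \<odot>\<^bsub>?R\<^esub> f)" if "g \<in> ?c f" for g
      using f that E.smult_closed[of f c] E.smult_closed[of g c]
      by (intro coset_eq) (simp_all add: coset path_algebra_simps(6))
    moreover have "f \<in> ?c f" using f by (simp add: coset)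
    ultimately show ?thesis unfolding A_simps by blast
  qed
  have add: "?c f \<oplus>\<^bsub>A\<^esub> ?c g = ?c (f \<oplus>\<^bsub>?R\<^esub> g)" if "f \<in> carrier ?R" "g \<in> carrier ?R" for f g
    unfolding A_simps using that by (rule I.a_rcos_sum)
  have mult: "?c f \<otimes>\<^bsub>A\<^esub> ?c g = ?c (f \<otimes>\<^bsub>?R\<^esub> g)" if "f \<in> carrier ?R" "g \<in> carrier ?R" for f g
    unfolding A_simps using that by (rule I.rcoset_mult_add)
  have zero: "\<zero>\<^bsub>A\<^esub> = ?c \<zero>\<^bsub>?R\<^esub>"
    unfolding A_simps
  proof (rule Set.set_eqI)
    fix f
    have "f \<in> I \<longleftrightarrow> f \<in> carrier ?R \<and> (\<forall>p\<in>B. f p = \<zero>\<^bsub>?R\<^esub> p)"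
      unfolding I path_algebra_simps(4) by blast
    also have "\<dots> \<longleftrightarrow> f \<in> ?c \<zero>\<^bsub>?R\<^esub>" by (rule coset[OF E.zero_closed, symmetric])
    finally show "f \<in> I \<longleftrightarrow> f \<in> ?c \<zero>\<^bsub>?R\<^esub>" .
  qed
  show "linear_embedding A coset_coord"
  proof (unfold_locales, unfold carrier)
    show "inj_on coset_coord (?c ` carrier ?R)"
    proof (rule inj_onI, clarify)
      fix f g assume f: "f \<in> carrier ?R" and g: "g \<in> carrier ?R"
        and eq: "coset_coord (?c f) = coset_coord (?c g)"
      have "f p = g p" if "p \<in> B" for p
        using fun_cong[OF eq, of p] that by (simp add: coord f g)
      then show "?c f = ?c g" by (intro coset_eq f g)
    qed
  qed (auto simp: zero add smult E.closed E.zero E.add E.smult coord intro!: imageI)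
  show "monoid A"
    using ring.is_monoid[OF I.quotient_is_ring] unfolding monoid_def A_simps
    by (simp add: FactRing_def)
  show "coset_coord (x \<otimes>\<^bsub>A\<^esub> y) p =
      (if p \<in> B then \<Sum>(q, r)\<in>splits p. coset_coord x q * coset_coord y r else 0)"
    if xy: "x \<in> carrier A" "y \<in> carrier A" for x y p
  proof -
    obtain f g where fg: "x = ?c f" "y = ?c g" "f \<in> carrier ?R" "g \<in> carrier ?R"
      using xy unfolding carrier by auto
    then have "f \<otimes>\<^bsub>?R\<^esub> g \<in> carrier ?R" by (intro path_algebra_mult_closed)
    then show ?thesis
      using fg by (auto simp: mult coord path_algebra_simps(2) dest: B_splits intro!: sum.cong)
  qed
  show "coset_coord ` carrier A = {f. finite {p. f p \<noteq> 0} \<and> {p. f p \<noteq> 0} \<subseteq> B}" (is "_ = ?F")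
  proof (intro equalityI subsetI)
    fix F assume "F \<in> coset_coord ` carrier A"
    then obtain f where f: "f \<in> carrier ?R" "F = coset_coord (?c f)" unfolding carrier by auto
    then have "{p. F p \<noteq> 0} \<subseteq> {p. f p \<noteq> 0} \<inter> B" by (auto simp: coord split: if_splits)
    with f show "F \<in> ?F" by (auto simp: path_algebra_simps(1) intro: finite_subset)
  next
    fix F assume F: "F \<in> ?F"
    then have "F \<in> carrier ?R" using B_paths by (auto simp: path_algebra_simps(1))
    with F show "F \<in> coset_coord ` carrier A"
      unfolding carrier by (intro image_eqI[of _ _ "?c F"]) (auto simp: coord fun_eq_iff)
  qed
qed

text \<open>The classes of the paths in B are a dual family, hence independent, so finite dimension
  forces B to be finite. Then finiteness of the support is automatic and the image consists of all
  functions supported on B.\<close>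

lemma monomial_algebra_coordinates:
  fixes A :: "('k::field, (('v, 'e) qpath \<Rightarrow> 'k) set) module"
  defines "A \<equiv> monomial_algebra Q Z"
  assumes "vectorspace.fin_dim class_ring A"
  shows "coordinates A coset_coord B"
proof -
  note facts = monomial_algebra_facts[where 'k = 'k, folded A_def]
  interpret A: linear_embedding A coset_coord by (rule facts(1))
  let ?e = "\<lambda>p. inv_into (carrier A) coset_coord (path_vector p)"
  have range: "path_vector p \<in> coset_coord ` carrier A" if "p \<in> B" for p
    using that unfolding facts(4) by auto
  have "finite B"
  proof (rule A.finite_dual_family[OF assms(2)])
    show "?e \<in> B \<rightarrow> carrier A" by (intro Pi_I inv_into_into range)
  qed (simp add: f_inv_into_f range)
  have "{f. finite {p. f p \<noteq> 0} \<and> {p. f p \<noteq> 0} \<subseteq> B} = {f :: _ \<Rightarrow> 'k. \<forall>p. p \<notin> B \<longrightarrow> f p = 0}"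
  proof (intro Collect_cong iffI conjI)
    fix f :: "_ \<Rightarrow> 'k" assume "\<forall>p. p \<notin> B \<longrightarrow> f p = 0"
    then show sub: "{p. f p \<noteq> 0} \<subseteq> B" by blast
    show "finite {p. f p \<noteq> 0}" by (rule finite_subset[OF sub \<open>finite B\<close>])
  qed blast
  with \<open>finite B\<close> show ?thesis
    by unfold_locales (simp_all only: facts(4))
qed

end

section \<open>Matrices that commute with arrows\<close>

context monomial
begin

text \<open>
  The matrix form of \<open>\<phi>(a f) = a \<phi>(f)\<close>, where \<open>c\<close> is the coordinate vector of \<open>a\<close>. The condition for
  the right action is the same one for the transposed matrix.
\<close>

definition left_balanced :: "(('v, 'e) qpath \<times> ('v, 'e) qpath \<Rightarrow> 'k::field) \<Rightarrow> bool" where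
  "left_balanced M \<longleftrightarrow> (\<forall>\<alpha>\<in>B. \<forall>\<beta>\<in>B. \<forall>c.
     (\<Sum>(q, r)\<in>splits \<beta>. M (\<alpha>, q) * c r) = (\<Sum>(r, q)\<in>splits \<alpha>. c r * M (q, \<beta>)))"

text \<open>The case \<open>a = p\<close>, in which each of the two sums has at most one term.\<close>

definition left_compatible ::
  "(('v, 'e) qpath \<times> ('v, 'e) qpath \<Rightarrow> 'k::field) \<Rightarrow> ('v, 'e) qpath \<Rightarrow> bool" where
  "left_compatible M p \<longleftrightarrow>
     (\<forall>\<alpha>\<in>B. \<forall>\<gamma>. cat_in_B Q Z \<gamma> p \<longrightarrow>
        (\<forall>\<alpha>'. (p, \<alpha>') \<in> splits \<alpha> \<longrightarrow> M (\<alpha>, \<gamma>) = M (\<alpha>', cat \<gamma> p)) \<and>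
        ((\<forall>\<alpha>'. (p, \<alpha>') \<notin> splits \<alpha>) \<longrightarrow> M (\<alpha>, \<gamma>) = 0)) \<and>
     (\<forall>\<beta>\<in>B. \<forall>\<alpha>'. cat_in_B Q Z p \<alpha>' \<longrightarrow> (\<forall>\<gamma>. (\<gamma>, p) \<notin> splits \<beta>) \<longrightarrow> M (\<alpha>', \<beta>) = 0)"

text \<open>The three parts distinguish whether both sums have a term for p, only the sum over
  factorizations of \<beta>, or only the sum over factorizations of \<alpha>.\<close>

lemma left_compatibleD:
  assumes "left_compatible M p"
  shows "composable Q p \<alpha>' \<Longrightarrow> cat p \<alpha>' \<in> B \<Longrightarrow> composable Q \<gamma> p \<Longrightarrow> cat \<gamma> p \<in> B \<Longrightarrow>
      M (cat p \<alpha>', \<gamma>) = M (\<alpha>', cat \<gamma> p)"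
    and "\<alpha> \<in> B \<Longrightarrow> composable Q \<gamma> p \<Longrightarrow> cat \<gamma> p \<in> B \<Longrightarrow> (\<And>\<alpha>'. (p, \<alpha>') \<notin> splits \<alpha>) \<Longrightarrow> M (\<alpha>, \<gamma>) = 0"
    and "\<beta> \<in> B \<Longrightarrow> composable Q p \<alpha>' \<Longrightarrow> cat p \<alpha>' \<in> B \<Longrightarrow> (\<And>\<gamma>. (\<gamma>, p) \<notin> splits \<beta>) \<Longrightarrow> M (\<alpha>', \<beta>) = 0"
  using assms unfolding left_compatible_def cat_in_B_def splits_iff by blast+

lemma splits_unique:
  "(q, p) \<in> splits \<beta> \<Longrightarrow> (q', p) \<in> splits \<beta> \<Longrightarrow> q = q'"
  "(p, q) \<in> splits \<beta> \<Longrightarrow> (p, q') \<in> splits \<beta> \<Longrightarrow> q = q'"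
  by (cases q; cases q'; cases p; auto simp: splits_iff)+

text \<open>Choosing for c the indicator function of p leaves at most one term in each sum.
  Conversely, a term vanishes if its factor r splits off one of the two paths but not the other, and
  the remaining terms of the two sums match through the common factor r.\<close>

lemma left_balanced_iff:
  fixes M :: "('v, 'e) qpath \<times> ('v, 'e) qpath \<Rightarrow> 'k::field"
  shows "left_balanced M \<longleftrightarrow> (\<forall>p. left_compatible M p)"
proof
  assume bal: "left_balanced M"
  have single_right: "(\<Sum>(q', r)\<in>splits \<beta>. f q' * (if r = p then 1 else 0)) = (f q :: 'k)"
    if "(q, p) \<in> splits \<beta>" for f q p \<beta>
  proof -
    have "(\<Sum>(q', r)\<in>splits \<beta>. f q' * (if r = p then 1 else 0)) =
        (\<Sum>x\<in>splits \<beta>. if x = (q, p) then f q else 0)"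
    proof (intro sum.cong refl)
      fix x assume "x \<in> splits \<beta>"
      then show "(case x of (q', r) \<Rightarrow> f q' * (if r = p then 1 else 0)) = (if x = (q, p) then f q else 0)"
        using splits_unique(1)[OF that] by (cases x; cases "snd x = p") auto
    qed
    with that show ?thesis by (simp add: finite_splits sum.delta)
  qed
  have single_left: "(\<Sum>(r, q')\<in>splits \<beta>. (if r = p then 1 else 0) * f q') = (f q :: 'k)"
    if "(p, q) \<in> splits \<beta>" for f q p \<beta>
  proof -
    have "(\<Sum>(r, q')\<in>splits \<beta>. (if r = p then 1 else 0) * f q') =
        (\<Sum>x\<in>splits \<beta>. if x = (p, q) then f q else 0)"
    proof (intro sum.cong refl)
      fix x assume "x \<in> splits \<beta>"
      then show "(case x of (r, q') \<Rightarrow> (if r = p then 1 else 0) * f q') = (if x = (p, q) then f q else 0)"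
        using splits_unique(2)[OF that] by (cases x; cases "fst x = p") auto
    qed
    with that show ?thesis by (simp add: finite_splits sum.delta)
  qed
  show "\<forall>p. left_compatible M p"
  proof
    fix p :: "('v, 'e) qpath"
    let ?d = "\<lambda>r. if r = p then 1 else (0::'k)"
    note eq = bal[unfolded left_balanced_def, rule_format, where c = ?d]
    have right_none: "(\<Sum>(q, r)\<in>splits \<beta>. f q * ?d r) = 0" if "\<And>\<gamma>. (\<gamma>, p) \<notin> splits \<beta>" for f \<beta>
      using that by (intro sum.neutral) auto
    have left_none: "(\<Sum>(r, q)\<in>splits \<alpha>. ?d r * f q) = 0" if "\<And>\<gamma>. (p, \<gamma>) \<notin> splits \<alpha>" for f \<alpha>
      using that by (intro sum.neutral) auto
    show "left_compatible M p"
      unfolding left_compatible_def cat_in_B_def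
    proof (intro conjI ballI allI impI; (elim conjE)?)
      fix \<alpha> \<gamma> \<alpha>' assume "\<alpha> \<in> B" "composable Q \<gamma> p" "cat \<gamma> p \<in> B" "(p, \<alpha>') \<in> splits \<alpha>"
      then show "M (\<alpha>, \<gamma>) = M (\<alpha>', cat \<gamma> p)"
        using eq[of \<alpha> "cat \<gamma> p"] single_right[of \<gamma> p "cat \<gamma> p" "\<lambda>q. M (\<alpha>, q)"]
          single_left[of p \<alpha>' \<alpha> "\<lambda>q. M (q, cat \<gamma> p)"] by (simp add: splits_iff)
    next
      fix \<alpha> \<gamma> assume "\<alpha> \<in> B" "composable Q \<gamma> p" "cat \<gamma> p \<in> B"
        and none: "\<forall>\<alpha>'. (p, \<alpha>') \<notin> splits \<alpha>"
      then show "M (\<alpha>, \<gamma>) = 0"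
        using eq[of \<alpha> "cat \<gamma> p"] single_right[of \<gamma> p "cat \<gamma> p" "\<lambda>q. M (\<alpha>, q)"]
          left_none[of \<alpha> "\<lambda>q. M (q, cat \<gamma> p)", OF none[rule_format]] by (simp add: splits_iff)
    next
      fix \<beta> \<alpha>' assume "\<beta> \<in> B" "composable Q p \<alpha>'" "cat p \<alpha>' \<in> B"
        and none: "\<forall>\<gamma>. (\<gamma>, p) \<notin> splits \<beta>"
      then show "M (\<alpha>', \<beta>) = 0"
        using eq[of "cat p \<alpha>'" \<beta>] single_left[of p \<alpha>' "cat p \<alpha>'" "\<lambda>q. M (q, \<beta>)"]
          right_none[of \<beta> "\<lambda>q. M (cat p \<alpha>', q)", OF none[rule_format]] by (simp add: splits_iff)
    qed
  qed
next
  assume comp: "\<forall>p. left_compatible M p"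
  show "left_balanced M"
    unfolding left_balanced_def
  proof (intro ballI allI)
    fix \<alpha> \<beta> c assume \<alpha>: "\<alpha> \<in> B" and \<beta>: "\<beta> \<in> B"
    let ?S = "{(q, r). (q, r) \<in> splits \<beta> \<and> (\<exists>q'. (r, q') \<in> splits \<alpha>)}"
    let ?T = "{(r, q). (r, q) \<in> splits \<alpha> \<and> (\<exists>q'. (q', r) \<in> splits \<beta>)}"
    have zero_S: "M (\<alpha>, q) = 0" if "(q, r) \<in> splits \<beta>" "\<And>q'. (r, q') \<notin> splits \<alpha>" for q r
      using left_compatibleD(2)[OF comp[rule_format, of r] \<alpha>, of q] that \<beta> by (auto simp: splits_iff)
    have zero_T: "M (q, \<beta>) = 0" if "(r, q) \<in> splits \<alpha>" "\<And>q'. (q', r) \<notin> splits \<beta>" for q r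
      using left_compatibleD(3)[OF comp[rule_format, of r] \<beta>, of q] that \<alpha> by (auto simp: splits_iff)
    have M_eq: "M (\<alpha>, q) = M (q', \<beta>)" if "(q, r) \<in> splits \<beta>" "(r, q') \<in> splits \<alpha>" for q q' r
      using left_compatibleD(1)[OF comp[rule_format, of r], of q' q] that \<alpha> \<beta> by (auto simp: splits_iff)
    have the_left: "(THE q'. (q', r) \<in> splits \<beta>) = q" if "(q, r) \<in> splits \<beta>" for q r
      using that by (rule the_equality) (rule splits_unique(1)[OF _ that])
    have the_right: "(THE q'. (r, q') \<in> splits \<alpha>) = q" if "(r, q) \<in> splits \<alpha>" for q r
      using that by (rule the_equality) (rule splits_unique(2)[OF _ that])
    have "(\<Sum>(q, r)\<in>splits \<beta>. M (\<alpha>, q) * c r) = (\<Sum>(q, r)\<in>?S. M (\<alpha>, q) * c r)"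
      by (rule sum.mono_neutral_right) (auto simp: finite_splits dest: zero_S)
    also have "\<dots> = (\<Sum>(r, q)\<in>?T. c r * M (q, \<beta>))"
      by (rule sum.reindex_bij_witness[of _ "\<lambda>(r, q). (THE q'. (q', r) \<in> splits \<beta>, r)"
            "\<lambda>(q, r). (r, THE q'. (r, q') \<in> splits \<alpha>)"])
        (auto simp: the_left the_right M_eq)
    also have "\<dots> = (\<Sum>(r, q)\<in>splits \<alpha>. c r * M (q, \<beta>))"
      by (rule sum.mono_neutral_left) (auto simp: finite_splits dest: zero_T)
    finally show "(\<Sum>(q, r)\<in>splits \<beta>. M (\<alpha>, q) * c r) = (\<Sum>(r, q)\<in>splits \<alpha>. c r * M (q, \<beta>))" .
  qed
qed

section \<open>From arrows to paths\<close>

lemma arrow_paths [simp]: "arrow Q a \<in> paths Q \<longleftrightarrow> a \<in> arcs Q"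
  by (auto simp: arrow_def)

text \<open>Lists run in the order of traversal, products from right to left, so the last arrow is a
  left factor and the first arrow a right factor. This translates neatness into the language of
  factorizations.\<close>

lemma is_last_arrow_iff:
  assumes "p \<in> paths Q"
  shows "is_last_arrow a p \<longleftrightarrow> (\<exists>q. (arrow Q a, q) \<in> splits p)"
proof
  assume "is_last_arrow a p"
  then obtain u es where "p = (u, es @ [a])"
    by (metis append_butlast_last_id is_last_arrow_def prod.collapse)
  with assms have "(arrow Q a, (u, es)) \<in> splits p"
    by (simp add: splits_iff arrow_def)
  then show "\<exists>q. (arrow Q a, q) \<in> splits p" by blast
qed (auto simp: is_last_arrow_def splits_iff cat_def arrow_def)

lemma is_first_arrow_iff:
  assumes "p \<in> paths Q"
  shows "is_first_arrow a p \<longleftrightarrow> (\<exists>q. (q, arrow Q a) \<in> splits p)"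
proof
  assume "is_first_arrow a p"
  then obtain u es where "p = (u, a # es)" by (cases p; cases "snd p") (auto simp: is_first_arrow_def)
  with assms have "((head Q a, es), arrow Q a) \<in> splits p"
    by (auto simp: splits_iff arrow_def)
  then show "\<exists>q. (q, arrow Q a) \<in> splits p" by blast
qed (auto simp: is_first_arrow_def splits_iff cat_def arrow_def)

text \<open>This is stated with generating moves and single pairs, the form in which conditions on
  arrows deliver it. The passage to equivalence classes is made separately.\<close>

definition neat_invariant :: "(('v, 'e) qpath \<times> ('v, 'e) qpath \<Rightarrow> 'k::field) \<Rightarrow> bool" where
  "neat_invariant M \<longleftrightarrow> (\<forall>x. x \<notin> cyclic_pairs Q Z \<longrightarrow> M x = 0) \<and>
     (\<forall>x y. move Q Z x y \<longrightarrow> M x = M y) \<and>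
     (\<forall>x\<in>cyclic_pairs Q Z. \<not> neat Q Z x \<longrightarrow> M x = 0)"

lemma cyclic_pairs_swap: "(\<beta>, \<alpha>) \<in> cyclic_pairs Q Z \<longleftrightarrow> (\<alpha>, \<beta>) \<in> cyclic_pairs Q Z"
  by (auto simp: cyclic_pairs_def)

lemma neat_swap: "neat Q Z (\<beta>, \<alpha>) \<longleftrightarrow> neat Q Z (\<alpha>, \<beta>)"
  by (auto simp: neat_def)

text \<open>The flip turns a left move into a right move and conversely, and reverses its direction;
  hence y comes before x in the conclusion.\<close>

lemma move_swap: "move Q Z x y \<Longrightarrow> move Q Z (prod.swap y) (prod.swap x)"
  by (induction rule: move.induct) (auto intro!: move.intros simp: cyclic_pairs_swap)

lemma neat_invariant_swap: "neat_invariant M \<Longrightarrow> neat_invariant (\<lambda>(\<alpha>, \<beta>). M (\<beta>, \<alpha>))"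
  unfolding neat_invariant_def
proof (intro conjI allI impI ballI; elim conjE)
  fix x y assume move: "\<forall>x y. move Q Z x y \<longrightarrow> M x = M y" and xy: "move Q Z x y"
  show "(\<lambda>(\<alpha>, \<beta>). M (\<beta>, \<alpha>)) x = (\<lambda>(\<alpha>, \<beta>). M (\<beta>, \<alpha>)) y"
    using move[rule_format, OF move_swap[OF xy]] by (cases x; cases y) simp
qed (auto simp: cyclic_pairs_swap neat_swap)

text \<open>Induction on the length of p, with the first arrow a split off as p = p'a. Moving p
  across a pair means moving p' and then a. If p cannot be moved, either p' is already blocked,
  which is the induction hypothesis, or the arrow a is blocked, and then a pair that is not neat
  appears, where M vanishes.\<close>

lemma neat_invariant_left_compatible:
  assumes "neat_invariant M"
  shows "left_compatible M p"
proof -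
  have outside: "M x = 0" if "x \<notin> cyclic_pairs Q Z" for x
    using assms that unfolding neat_invariant_def by blast
  have move: "M x = M y" if "move Q Z x y" for x y
    using assms that unfolding neat_invariant_def by blast
  have not_neat: "M (\<alpha>, \<beta>) = 0" if "\<not> neat Q Z (\<alpha>, \<beta>)" for \<alpha> \<beta>
    using assms outside that unfolding neat_invariant_def by blast
  have last: "M (\<alpha>, \<beta>) = 0"
    if "composable Q \<beta> (arrow Q a)" "cat \<beta> (arrow Q a) \<in> B" "\<not> is_last_arrow a \<alpha>" for \<alpha> \<beta> a
    using that by (intro not_neat) (auto simp: neat_def cat_in_B_def composable_def)
  have first: "M (\<alpha>, \<beta>) = 0"
    if "composable Q (arrow Q a) \<alpha>" "cat (arrow Q a) \<alpha> \<in> B" "\<not> is_first_arrow a \<beta>" for \<alpha> \<beta> a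
    using that by (intro not_neat) (auto simp: neat_def cat_in_B_def composable_def)
  have base: "M (cat (arrow Q a) \<alpha>, \<beta>) = M (\<alpha>, cat \<beta> (arrow Q a))"
    if a: "composable Q (arrow Q a) \<alpha>" "cat (arrow Q a) \<alpha> \<in> B"
      "composable Q \<beta> (arrow Q a)" "cat \<beta> (arrow Q a) \<in> B" for a \<alpha> \<beta>
  proof -
    have "a \<in> arcs Q" using a by (auto simp: composable_def)
    \<comment> \<open>Moving an arrow does not affect whether a pair is cyclic. If the pairs are not
      cyclic, no move relates them, but then M vanishes on both.\<close>
    have iff: "(cat (arrow Q a) \<alpha>, \<beta>) \<in> cyclic_pairs Q Z \<longleftrightarrow> (\<alpha>, cat \<beta> (arrow Q a)) \<in> cyclic_pairs Q Z"
      using a B_cat[OF a(2,1)] B_cat[OF a(4,3)] tgt_cat[OF a(1)] tgt_cat[OF a(3)]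
      by (auto simp: cyclic_pairs_def composable_def)
    show ?thesis
    proof (cases "(cat (arrow Q a) \<alpha>, \<beta>) \<in> cyclic_pairs Q Z")
      case True
      with iff a \<open>a \<in> arcs Q\<close> show ?thesis by (intro move move.left) auto
    next
      case False
      with iff show ?thesis by (simp add: outside)
    qed
  qed
  have "left_compatible M (u, es)" for u es
  proof (induction es arbitrary: u)
    \<comment> \<open>A vertex u splits off a path on the left iff the path ends at u, and on the
      right iff it starts at u. So a mismatch means that the pair is not cyclic.\<close>
    case Nil
    show ?case
      unfolding left_compatible_def cat_in_B_def
    proof (intro conjI ballI allI impI; (elim conjE)?)
      fix \<alpha> \<gamma> \<alpha>' assume "composable Q \<gamma> (u, [])" "((u, []), \<alpha>') \<in> splits \<alpha>"
      then show "M (\<alpha>, \<gamma>) = M (\<alpha>', cat \<gamma> (u, []))"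
        by (cases \<gamma>; cases \<alpha>') (auto simp: splits_iff)
    next
      fix \<alpha> \<gamma> assume *: "\<alpha> \<in> B" "composable Q \<gamma> (u, [])" "\<forall>\<alpha>'. ((u, []), \<alpha>') \<notin> splits \<alpha>"
      then have "tgt Q \<alpha> \<noteq> u"
        using B_paths[of \<alpha>] by (cases \<alpha>) (fastforce simp: splits_iff)
      with * show "M (\<alpha>, \<gamma>) = 0" by (intro outside) (auto simp: cyclic_pairs_def composable_def)
    next
      fix \<beta> \<alpha>' assume *: "\<beta> \<in> B" "composable Q (u, []) \<alpha>'" "\<forall>\<gamma>. (\<gamma>, (u, [])) \<notin> splits \<beta>"
      then have "fst \<beta> \<noteq> u"
        using B_paths[of \<beta>] fst_in_verts[of \<beta>] by (cases \<beta>) (fastforce simp: splits_iff)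
      with * show "M (\<alpha>', \<beta>) = 0" by (intro outside) (auto simp: cyclic_pairs_def composable_def)
    qed
  next
    case (Cons a es)
    \<comment> \<open>The head of the list is traversed first, so the whole path is
      \<open>?p\<close> times the arrow a, with a as right factor.\<close>
    let ?p = "(head Q a, es)"
    show ?case
    proof (cases "a \<in> arcs Q \<and> tail Q a = u \<and> ?p \<in> paths Q")
      case False
      then show ?thesis
        unfolding left_compatible_def cat_in_B_def splits_iff by (auto simp: composable_def)
    next
      case True
      then have p: "(u, a # es) = cat ?p (arrow Q a)" and comp: "composable Q ?p (arrow Q a)"
        by (auto simp: arrow_def)
      note IH = left_compatibleD[OF Cons.IH[of "head Q a"]]
      show ?thesis
        unfolding left_compatible_def cat_in_B_def p
      proof (intro conjI ballI allI impI; (elim conjE)?)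
        fix \<alpha> \<gamma> \<alpha>'
        assume \<alpha>: "\<alpha> \<in> B" and \<gamma>: "composable Q \<gamma> (cat ?p (arrow Q a))" "cat \<gamma> (cat ?p (arrow Q a)) \<in> B"
          and \<alpha>': "(cat ?p (arrow Q a), \<alpha>') \<in> splits \<alpha>"
        have \<gamma>p: "composable Q \<gamma> ?p" using \<gamma> comp by (simp add: composable_cat_right)
        have \<gamma>p_a: "composable Q (cat \<gamma> ?p) (arrow Q a)" using \<gamma>p comp by (simp add: composable_cat_left)
        have a\<alpha>': "composable Q (arrow Q a) \<alpha>'"
          using \<alpha>' comp by (simp add: splits_iff composable_cat_left)
        have p_a\<alpha>': "composable Q ?p (cat (arrow Q a) \<alpha>')" using a\<alpha>' comp by (simp add: composable_cat_right)
        have \<alpha>_eq: "\<alpha> = cat ?p (cat (arrow Q a) \<alpha>')" using \<alpha>' by (simp add: splits_iff cat_assoc)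
        have inB: "cat \<gamma> ?p \<in> B" "cat (arrow Q a) \<alpha>' \<in> B"
          using B_cat[of "cat \<gamma> ?p" "arrow Q a"] B_cat[of ?p "cat (arrow Q a) \<alpha>'"] \<gamma> \<gamma>p_a \<alpha> \<alpha>_eq p_a\<alpha>'
          by (simp_all add: cat_assoc)
        have "M (\<alpha>, \<gamma>) = M (cat (arrow Q a) \<alpha>', cat \<gamma> ?p)"
          unfolding \<alpha>_eq using p_a\<alpha>' \<alpha> \<alpha>_eq \<gamma>p inB by (intro IH(1)) auto
        also have "\<dots> = M (\<alpha>', cat (cat \<gamma> ?p) (arrow Q a))"
          using a\<alpha>' inB \<gamma>p_a \<gamma> by (intro base) (auto simp: cat_assoc)
        finally show "M (\<alpha>, \<gamma>) = M (\<alpha>', cat \<gamma> (cat ?p (arrow Q a)))" by (simp add: cat_assoc)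
      next
        fix \<alpha> \<gamma>
        assume \<alpha>: "\<alpha> \<in> B" and \<gamma>: "composable Q \<gamma> (cat ?p (arrow Q a))" "cat \<gamma> (cat ?p (arrow Q a)) \<in> B"
          and none: "\<forall>\<alpha>'. (cat ?p (arrow Q a), \<alpha>') \<notin> splits \<alpha>"
        have \<gamma>p: "composable Q \<gamma> ?p" using \<gamma> comp by (simp add: composable_cat_right)
        have \<gamma>p_a: "composable Q (cat \<gamma> ?p) (arrow Q a)" using \<gamma>p comp by (simp add: composable_cat_left)
        have inB: "cat \<gamma> ?p \<in> B"
          using B_cat[of "cat \<gamma> ?p" "arrow Q a"] \<gamma> \<gamma>p_a by (simp add: cat_assoc)
        \<comment> \<open>If \<open>?p\<close> splits off \<alpha>, it is moved over to \<gamma>.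
          The rest of \<alpha> cannot end with a, since otherwise the whole path would split off
          \<alpha>; so neatness fails for the new pair.\<close>
        show "M (\<alpha>, \<gamma>) = 0"
        proof (cases "\<exists>\<alpha>'. (?p, \<alpha>') \<in> splits \<alpha>")
          case True
          then obtain \<alpha>' where \<alpha>': "composable Q ?p \<alpha>'" "\<alpha> = cat ?p \<alpha>'" by (auto simp: splits_iff)
          have "\<not> is_last_arrow a \<alpha>'"
          proof
            assume "is_last_arrow a \<alpha>'"
            then obtain q where q: "composable Q (arrow Q a) q" "\<alpha>' = cat (arrow Q a) q"
              using \<alpha>'(1) is_last_arrow_iff[of \<alpha>' a] by (auto simp: composable_def splits_iff)
            then have "(cat ?p (arrow Q a), q) \<in> splits \<alpha>"
              using \<alpha>' comp by (simp add: splits_iff cat_assoc composable_cat_left)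
            with none show False by blast
          qed
          moreover have "M (\<alpha>, \<gamma>) = M (\<alpha>', cat \<gamma> ?p)"
            unfolding \<alpha>'(2) using \<alpha>' \<alpha> \<gamma>p inB by (intro IH(1)) auto
          ultimately show ?thesis using last[of "cat \<gamma> ?p" a \<alpha>'] \<gamma>p_a \<gamma> by (simp add: cat_assoc)
        next
          case False
          then show ?thesis using \<alpha> \<gamma>p inB by (intro IH(2)) auto
        qed
      next
        fix \<beta> \<alpha>'
        assume \<beta>: "\<beta> \<in> B" and \<alpha>': "composable Q (cat ?p (arrow Q a)) \<alpha>'" "cat (cat ?p (arrow Q a)) \<alpha>' \<in> B"
          and none: "\<forall>\<gamma>. (\<gamma>, cat ?p (arrow Q a)) \<notin> splits \<beta>"
        have a\<alpha>': "composable Q (arrow Q a) \<alpha>'"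
          using \<alpha>' comp by (simp add: composable_cat_left)
        have p_a\<alpha>': "composable Q ?p (cat (arrow Q a) \<alpha>')" using a\<alpha>' comp by (simp add: composable_cat_right)
        have inB: "cat (arrow Q a) \<alpha>' \<in> B"
          using B_cat[of ?p "cat (arrow Q a) \<alpha>'"] \<alpha>' p_a\<alpha>' by (simp add: cat_assoc)
        \<comment> \<open>If \<beta> starts with a, this arrow is moved over to \<alpha>'. What is
          left of \<beta> does not start with \<open>?p\<close>, so the induction hypothesis
          applies; if \<beta> does not start with a, neatness fails at once.\<close>
        show "M (\<alpha>', \<beta>) = 0"
        proof (cases "is_first_arrow a \<beta>")
          case True
          then obtain \<gamma> where \<gamma>: "composable Q \<gamma> (arrow Q a)" "\<beta> = cat \<gamma> (arrow Q a)"
            using is_first_arrow_iff[OF B_paths[OF \<beta>]] by (auto simp: splits_iff)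
          have "M (\<alpha>', \<beta>) = M (cat (arrow Q a) \<alpha>', \<gamma>)"
            unfolding \<gamma>(2) using a\<alpha>' inB \<gamma> \<beta> by (intro base[symmetric]) auto
          also have "\<dots> = 0"
          proof (rule IH(3))
            show "\<gamma> \<in> B" using B_cat[of \<gamma> "arrow Q a"] \<gamma> \<beta> by simp
            show "(q, ?p) \<notin> splits \<gamma>" for q
            proof
              assume "(q, ?p) \<in> splits \<gamma>"
              then have "(q, cat ?p (arrow Q a)) \<in> splits \<beta>"
                using \<gamma> comp by (auto simp: splits_iff cat_assoc composable_cat_right)
              with none show False by blast
            qed
          qed (use p_a\<alpha>' \<alpha>' in \<open>simp_all add: cat_assoc\<close>)
          finally show ?thesis .
        next
          case False
          then show ?thesis using first a\<alpha>' inB by blast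
        qed
      qed
    qed
  qed
  then show ?thesis by (cases p) auto
qed

text \<open>In the direction from the balance conditions, trivial paths and arrows suffice: trivial
  paths force M to live on cyclic pairs, arrows give invariance under moves and vanishing at pairs
  that are not neat. The assumption on the support is present because the balance conditions speak
  only of paths in B.\<close>

lemma neat_invariant_iff:
  assumes support: "\<And>\<alpha> \<beta>. \<alpha> \<notin> B \<or> \<beta> \<notin> B \<Longrightarrow> M (\<alpha>, \<beta>) = 0"
  shows "neat_invariant M \<longleftrightarrow> left_balanced M \<and> left_balanced (\<lambda>(\<alpha>, \<beta>). M (\<beta>, \<alpha>))"
proof
  assume "neat_invariant M"
  then show "left_balanced M \<and> left_balanced (\<lambda>(\<alpha>, \<beta>). M (\<beta>, \<alpha>))"
    by (simp add: left_balanced_iff neat_invariant_left_compatible neat_invariant_swap)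
next
  assume "left_balanced M \<and> left_balanced (\<lambda>(\<alpha>, \<beta>). M (\<beta>, \<alpha>))"
  then have comp: "left_compatible M p" and comp': "left_compatible (\<lambda>(\<alpha>, \<beta>). M (\<beta>, \<alpha>)) p" for p
    unfolding left_balanced_iff by blast+
  note L = left_compatibleD[OF comp] and R = left_compatibleD[OF comp', simplified]
  \<comment> \<open>The test path is the vertex where \<beta> starts. It splits off \<beta> on the
    right, but not off \<alpha> on the left, because \<alpha> ends elsewhere.\<close>
  have tgt_left: "M (\<alpha>, \<beta>) = 0" if "\<alpha> \<in> B" "\<beta> \<in> B" "tgt Q \<alpha> \<noteq> fst \<beta>" for \<alpha> \<beta>
    using that fst_in_verts[OF B_paths[of \<beta>]] B_paths[of \<beta>]
    by (intro L(2)[of \<alpha> \<beta> "(fst \<beta>, [])"]) (auto simp: composable_def splits_iff cat_def)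
  have tgt_right: "M (\<beta>, \<alpha>) = 0" if "\<alpha> \<in> B" "\<beta> \<in> B" "tgt Q \<alpha> \<noteq> fst \<beta>" for \<alpha> \<beta>
    using that fst_in_verts[OF B_paths[of \<beta>]] B_paths[of \<beta>]
    by (intro R(2)[of \<alpha> \<beta> "(fst \<beta>, [])"]) (auto simp: composable_def splits_iff cat_def)
  show "neat_invariant M"
    unfolding neat_invariant_def
  proof (intro conjI allI impI ballI)
    fix x assume "x \<notin> cyclic_pairs Q Z"
    then obtain \<alpha> \<beta> where x_eq: "x = (\<alpha>, \<beta>)"
      and "\<alpha> \<notin> B \<or> \<beta> \<notin> B \<or> \<alpha> \<in> B \<and> \<beta> \<in> B \<and> (tgt Q \<beta> \<noteq> fst \<alpha> \<or> tgt Q \<alpha> \<noteq> fst \<beta>)"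
      by (cases x) (auto simp: cyclic_pairs_def)
    then show "M x = 0"
      unfolding x_eq using support tgt_left tgt_right by blast
  next
    fix x y assume "move Q Z x y"
    then show "M x = M y"
    proof cases
      case (left a \<alpha> \<beta>)
      then show ?thesis using L(1)[of "arrow Q a" \<alpha> \<beta>] by (auto simp: cyclic_pairs_def)
    next
      case (right b \<alpha> \<beta>)
      then show ?thesis using R(1)[of "arrow Q b" \<beta> \<alpha>] by (auto simp: cyclic_pairs_def)
    qed
  next
    fix x assume x: "x \<in> cyclic_pairs Q Z" "\<not> neat Q Z x"
    obtain \<alpha> \<beta> where x_eq: "x = (\<alpha>, \<beta>)" by (cases x)
    have inB: "\<alpha> \<in> B" "\<beta> \<in> B" using x by (auto simp: x_eq cyclic_pairs_def)
    \<comment> \<open>There are four ways to violate neatness. The left action excludes those with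
      \<beta>a or a\<alpha> in B, the transposed matrix those with a\<beta> or \<alpha>a in
      B.\<close>
    note arrows = is_last_arrow_iff[OF B_paths] is_first_arrow_iff[OF B_paths]
    from x(2) obtain a where
      "cat_in_B Q Z \<beta> (arrow Q a) \<and> \<not> is_last_arrow a \<alpha> \<or> cat_in_B Q Z (arrow Q a) \<beta> \<and> \<not> is_first_arrow a \<alpha> \<or>
       cat_in_B Q Z \<alpha> (arrow Q a) \<and> \<not> is_last_arrow a \<beta> \<or> cat_in_B Q Z (arrow Q a) \<alpha> \<and> \<not> is_first_arrow a \<beta>"
      unfolding x_eq neat_def by auto
    then show "M x = 0"
      using L(2)[of \<alpha> \<beta> "arrow Q a"] R(3)[of \<alpha> "arrow Q a" \<beta>] R(2)[of \<beta> \<alpha> "arrow Q a"] L(3)[of \<beta> "arrow Q a" \<alpha>] inB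
      unfolding x_eq cat_in_B_def by (auto simp: arrows)
  qed
qed

end

section \<open>Morphisms from the dual bimodule\<close>

text \<open>Cosets are left behind here: the algebra enters only through its coordinates, the
  convolution formula for products and the monoid laws.\<close>

locale monomial_coordinates =
  monomial Q Z + A: coordinates A h "Bpaths Q Z"
  for Q :: "('v, 'e) pre_digraph" and Z :: "('v, 'e) qpath set"
    and A :: "('k::field, 'a) module" and h :: "'a \<Rightarrow> ('v, 'e) qpath \<Rightarrow> 'k" +
  assumes monoid: "Group.monoid A"
    and mult: "x \<in> carrier A \<Longrightarrow> y \<in> carrier A \<Longrightarrow> h (x \<otimes>\<^bsub>A\<^esub> y) p =
      (if p \<in> Bpaths Q Z then \<Sum>(q, r)\<in>splits p. h x q * h y r else 0)"
begin

sublocale D: coordinates "dual A" "dual_coord A h B" B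
  by (rule dual_coordinates) (rule A.coordinates_axioms)

definition matrix :: "(('a \<Rightarrow> 'k) \<Rightarrow> 'a) \<Rightarrow> ('v, 'e) qpath \<times> ('v, 'e) qpath \<Rightarrow> 'k" where
  "matrix = hom_coord (dual A) (dual_coord A h B) B h"

sublocale H: coordinates "hom_space (dual A) A" matrix "B \<times> B"
  unfolding matrix_def
  by (rule hom_space_coordinates) (rule D.coordinates_axioms A.coordinates_axioms)+

lemma matrix_support: "\<phi> \<in> carrier (hom_space (dual A) A) \<Longrightarrow> \<alpha> \<notin> B \<or> \<beta> \<notin> B \<Longrightarrow> matrix \<phi> (\<alpha>, \<beta>) = 0"
  by (rule H.outside) auto

lemmas one_closed = Group.monoid.one_closed[OF monoid]
  and mult_closed = Group.monoid.m_closed[OF monoid]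
  and l_one = Group.monoid.l_one[OF monoid]
  and r_one = Group.monoid.r_one[OF monoid]

lemma dual_iff:
  "f \<in> carrier (dual A) \<longleftrightarrow> f \<in> extensional (carrier A) \<and>
    (\<forall>x\<in>carrier A. \<forall>y\<in>carrier A. f (x \<oplus>\<^bsub>A\<^esub> y) = f x + f y) \<and>
    (\<forall>c. \<forall>x\<in>carrier A. f (c \<odot>\<^bsub>A\<^esub> x) = c * f x)"
  by (auto simp: dual_def hom_space_simps LinearCombinations.module_hom_def ground_space_def)

lemma dual_expansion:
  assumes "f \<in> carrier (dual A)" "x \<in> carrier A"
  shows "f x = (\<Sum>p\<in>B. f (A.e p) * h x p)"
proof -
  interpret G: coordinates ground_space "\<lambda>x (_::unit). x" UNIV by (rule ground_space_coordinates)
  have "f \<in> LinearCombinations.module_hom class_ring A ground_space"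
    using assms by (simp add: dual_def hom_space_simps)
  from A.hom_expansion[OF G.linear_embedding_axioms this assms(2)] show ?thesis .
qed

lemma dual_e: "\<beta> \<in> B \<Longrightarrow> p \<in> B \<Longrightarrow> D.e \<beta> (A.e p) = (if p = \<beta> then 1 else 0)"
  using D.e_coord[of \<beta> p] by (simp add: dual_coord_def)

lemma hom_coordinates:
  assumes "\<phi> \<in> carrier (hom_space (dual A) A)" "f \<in> carrier (dual A)"
  shows "h (\<phi> f) \<alpha> = (\<Sum>\<beta>\<in>B. matrix \<phi> (\<alpha>, \<beta>) * f (A.e \<beta>))"
proof -
  have "h (\<phi> f) \<alpha> = (\<Sum>\<beta>\<in>B. h (\<phi> (D.e \<beta>)) \<alpha> * dual_coord A h B f \<beta>)"
    using assms by (intro D.hom_expansion[OF A.linear_embedding_axioms]) (simp_all add: hom_space_simps)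
  also have "\<dots> = (\<Sum>\<beta>\<in>B. matrix \<phi> (\<alpha>, \<beta>) * f (A.e \<beta>))"
    by (intro sum.cong) (auto simp: matrix_def hom_coord_def dual_coord_def)
  finally show ?thesis .
qed

lemma hom_closed: "\<phi> \<in> carrier (hom_space (dual A) A) \<Longrightarrow> f \<in> carrier (dual A) \<Longrightarrow> \<phi> f \<in> carrier A"
  by (auto simp: hom_space_simps dest: module_hom_closed)

section \<open>The two one-sided actions in coordinates\<close>

lemma mult_e_right:
  assumes "a \<in> carrier A" "\<gamma> \<in> B" "\<beta> \<in> B"
  shows "h (A.e \<gamma> \<otimes>\<^bsub>A\<^esub> a) \<beta> = (\<Sum>(q, r)\<in>splits \<beta>. if q = \<gamma> then h a r else 0)"
  using assms by (auto simp: mult A.e_closed A.e_coord intro!: sum.cong)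

lemma mult_e_left:
  assumes "a \<in> carrier A" "\<gamma> \<in> B" "\<beta> \<in> B"
  shows "h (a \<otimes>\<^bsub>A\<^esub> A.e \<gamma>) \<beta> = (\<Sum>(r, q)\<in>splits \<beta>. if q = \<gamma> then h a r else 0)"
  using assms by (auto simp: mult A.e_closed A.e_coord intro!: sum.cong)

text \<open>This is the element af of DA: acting on the left of the functional means multiplying its
  argument on the right. Likewise \<open>right_translate\<close> is the right action fb.\<close>

definition left_translate :: "'a \<Rightarrow> ('a \<Rightarrow> 'k) \<Rightarrow> 'a \<Rightarrow> 'k" where
  "left_translate a f = (\<lambda>x\<in>carrier A. f (x \<otimes>\<^bsub>A\<^esub> a))"

definition right_translate :: "'a \<Rightarrow> ('a \<Rightarrow> 'k) \<Rightarrow> 'a \<Rightarrow> 'k" where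
  "right_translate b f = (\<lambda>x\<in>carrier A. f (b \<otimes>\<^bsub>A\<^esub> x))"

lemma mult_linear:
  assumes "a \<in> carrier A" "x \<in> carrier A" "y \<in> carrier A"
  shows "(x \<oplus>\<^bsub>A\<^esub> y) \<otimes>\<^bsub>A\<^esub> a = x \<otimes>\<^bsub>A\<^esub> a \<oplus>\<^bsub>A\<^esub> y \<otimes>\<^bsub>A\<^esub> a"
    "(c \<odot>\<^bsub>A\<^esub> x) \<otimes>\<^bsub>A\<^esub> a = c \<odot>\<^bsub>A\<^esub> (x \<otimes>\<^bsub>A\<^esub> a)"
    "a \<otimes>\<^bsub>A\<^esub> (x \<oplus>\<^bsub>A\<^esub> y) = a \<otimes>\<^bsub>A\<^esub> x \<oplus>\<^bsub>A\<^esub> a \<otimes>\<^bsub>A\<^esub> y"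
    "a \<otimes>\<^bsub>A\<^esub> (c \<odot>\<^bsub>A\<^esub> x) = c \<odot>\<^bsub>A\<^esub> (a \<otimes>\<^bsub>A\<^esub> x)"
  using assms
  by (intro A.eqI; simp add: mult A.closed A.add A.smult mult_closed split_def
      sum.distrib sum_distrib_left distrib_left distrib_right mult_ac)+

lemma translate_closed:
  assumes "a \<in> carrier A" "f \<in> carrier (dual A)"
  shows "left_translate a f \<in> carrier (dual A)" "right_translate a f \<in> carrier (dual A)"
  using assms
  by (auto simp: dual_iff left_translate_def right_translate_def A.closed mult_closed mult_linear)

lemma dual_act_eq:
  assumes "a \<in> carrier A" "b \<in> carrier A"
  shows "dual_act A a f b = right_translate b (left_translate a f)"
  using assms by (auto simp: dual_act_def right_translate_def left_translate_def mult_closed)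

lemma dual_act_one:
  assumes "a \<in> carrier A" "f \<in> carrier (dual A)"
  shows "dual_act A a f \<one>\<^bsub>A\<^esub> = left_translate a f" "dual_act A \<one>\<^bsub>A\<^esub> f a = right_translate a f"
  using assms by (auto simp: dual_act_def right_translate_def left_translate_def mult_closed l_one r_one)

text \<open>Putting the unit in place of one of the two scalars gives the one-sided conditions, and
  afb = (af)b puts them together again.\<close>

lemma bimodule_homs_iff:
  "\<phi> \<in> bimodule_homs A \<longleftrightarrow> \<phi> \<in> carrier (hom_space (dual A) A) \<and>
    (\<forall>a\<in>carrier A. \<forall>f\<in>carrier (dual A). \<phi> (left_translate a f) = a \<otimes>\<^bsub>A\<^esub> \<phi> f) \<and>
    (\<forall>b\<in>carrier A. \<forall>f\<in>carrier (dual A). \<phi> (right_translate b f) = \<phi> f \<otimes>\<^bsub>A\<^esub> b)"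
  (is "_ \<longleftrightarrow> ?H \<and> ?L \<and> ?R")
proof (intro iffI conjI ballI)
  assume \<phi>: "\<phi> \<in> bimodule_homs A"
  then show ?H by (simp add: bimodule_homs_def)
  fix a f assume af: "a \<in> carrier A" "f \<in> carrier (dual A)"
  have "\<phi> (dual_act A a f \<one>\<^bsub>A\<^esub>) = a \<otimes>\<^bsub>A\<^esub> \<phi> f \<otimes>\<^bsub>A\<^esub> \<one>\<^bsub>A\<^esub>"
    "\<phi> (dual_act A \<one>\<^bsub>A\<^esub> f a) = \<one>\<^bsub>A\<^esub> \<otimes>\<^bsub>A\<^esub> \<phi> f \<otimes>\<^bsub>A\<^esub> a"
    using \<phi> af one_closed unfolding bimodule_homs_def by auto
  then show "\<phi> (left_translate a f) = a \<otimes>\<^bsub>A\<^esub> \<phi> f" "\<phi> (right_translate a f) = \<phi> f \<otimes>\<^bsub>A\<^esub> a"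
    using af \<open>?H\<close> by (simp_all add: dual_act_one l_one r_one mult_closed hom_closed)
next
  assume "?H \<and> ?L \<and> ?R"
  then show "\<phi> \<in> bimodule_homs A"
    by (simp add: bimodule_homs_def dual_act_eq translate_closed)
qed

text \<open>This lemma and its three companions bring both sides of \<phi>(af) = a\<phi>(f) and of
  \<phi>(fa) = \<phi>(f)a into the shape of a linear form in the values of f on the basis, so that
  coefficients can be compared.\<close>

lemma left_translate_coord:
  assumes \<phi>: "\<phi> \<in> carrier (hom_space (dual A) A)" and f: "f \<in> carrier (dual A)"
    and a: "a \<in> carrier A"
  shows "h (\<phi> (left_translate a f)) \<alpha> =
    (\<Sum>\<beta>\<in>B. f (A.e \<beta>) * (\<Sum>(q, r)\<in>splits \<beta>. matrix \<phi> (\<alpha>, q) * h a r))"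
proof -
  have "h (\<phi> (left_translate a f)) \<alpha> = (\<Sum>\<gamma>\<in>B. matrix \<phi> (\<alpha>, \<gamma>) * f (A.e \<gamma> \<otimes>\<^bsub>A\<^esub> a))"
    unfolding hom_coordinates[OF \<phi> translate_closed(1)[OF a f]]
    by (intro sum.cong refl) (simp add: left_translate_def A.e_closed)
  also have "\<dots> = (\<Sum>\<gamma>\<in>B. \<Sum>\<beta>\<in>B. f (A.e \<beta>) * (matrix \<phi> (\<alpha>, \<gamma>) * h (A.e \<gamma> \<otimes>\<^bsub>A\<^esub> a) \<beta>))"
    using f a by (intro sum.cong refl)
      (subst dual_expansion, auto simp: mult_closed A.e_closed sum_distrib_left mult_ac)
  also have "\<dots> = (\<Sum>\<beta>\<in>B. f (A.e \<beta>) * (\<Sum>\<gamma>\<in>B. matrix \<phi> (\<alpha>, \<gamma>) * h (A.e \<gamma> \<otimes>\<^bsub>A\<^esub> a) \<beta>))"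
    by (subst sum.swap) (simp add: sum_distrib_left)
  also have "\<dots> = (\<Sum>\<beta>\<in>B. f (A.e \<beta>) * (\<Sum>(q, r)\<in>splits \<beta>. matrix \<phi> (\<alpha>, q) * h a r))"
  proof (intro sum.cong refl arg_cong2[where f = "(*)"])
    fix \<beta> assume \<beta>: "\<beta> \<in> B"
    have "(\<Sum>\<gamma>\<in>B. matrix \<phi> (\<alpha>, \<gamma>) * h (A.e \<gamma> \<otimes>\<^bsub>A\<^esub> a) \<beta>) =
        (\<Sum>\<gamma>\<in>B. \<Sum>x\<in>splits \<beta>. if fst x = \<gamma> then matrix \<phi> (\<alpha>, \<gamma>) * h a (snd x) else 0)"
      using a \<beta> by (intro sum.cong refl) (simp add: mult_e_right sum_distrib_left split_def if_distrib cong: if_cong)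
    also have "\<dots> = (\<Sum>x\<in>splits \<beta>. \<Sum>\<gamma>\<in>B. if fst x = \<gamma> then matrix \<phi> (\<alpha>, \<gamma>) * h a (snd x) else 0)"
      by (rule sum.swap)
    \<comment> \<open>The inner sum over B meets the left factor of each factorization, because
      factors of \<beta> are themselves in B.\<close>
    also have "\<dots> = (\<Sum>(q, r)\<in>splits \<beta>. matrix \<phi> (\<alpha>, q) * h a r)"
      using \<beta> A.finite_index by (intro sum.cong refl) (auto simp: sum.delta' dest: B_splits)
    finally show "(\<Sum>\<gamma>\<in>B. matrix \<phi> (\<alpha>, \<gamma>) * h (A.e \<gamma> \<otimes>\<^bsub>A\<^esub> a) \<beta>) =
      (\<Sum>(q, r)\<in>splits \<beta>. matrix \<phi> (\<alpha>, q) * h a r)" .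
  qed
  finally show ?thesis .
qed

lemma left_mult_coord:
  assumes \<phi>: "\<phi> \<in> carrier (hom_space (dual A) A)" and f: "f \<in> carrier (dual A)"
    and a: "a \<in> carrier A" and \<alpha>: "\<alpha> \<in> B"
  shows "h (a \<otimes>\<^bsub>A\<^esub> \<phi> f) \<alpha> =
    (\<Sum>\<beta>\<in>B. f (A.e \<beta>) * (\<Sum>(r, q)\<in>splits \<alpha>. h a r * matrix \<phi> (q, \<beta>)))"
proof -
  have "h (a \<otimes>\<^bsub>A\<^esub> \<phi> f) \<alpha> = (\<Sum>x\<in>splits \<alpha>. \<Sum>\<beta>\<in>B. f (A.e \<beta>) * (h a (fst x) * matrix \<phi> (snd x, \<beta>)))"
    using assms by (simp add: mult hom_closed hom_coordinates sum_distrib_left split_def mult_ac)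
  also have "\<dots> = (\<Sum>\<beta>\<in>B. f (A.e \<beta>) * (\<Sum>(r, q)\<in>splits \<alpha>. h a r * matrix \<phi> (q, \<beta>)))"
    by (subst sum.swap) (simp add: sum_distrib_left split_def)
  finally show ?thesis .
qed

lemma right_translate_coord:
  assumes \<phi>: "\<phi> \<in> carrier (hom_space (dual A) A)" and f: "f \<in> carrier (dual A)"
    and a: "a \<in> carrier A"
  shows "h (\<phi> (right_translate a f)) \<alpha> =
    (\<Sum>\<beta>\<in>B. f (A.e \<beta>) * (\<Sum>(r, q)\<in>splits \<beta>. h a r * matrix \<phi> (\<alpha>, q)))"
proof -
  have "h (\<phi> (right_translate a f)) \<alpha> = (\<Sum>\<gamma>\<in>B. matrix \<phi> (\<alpha>, \<gamma>) * f (a \<otimes>\<^bsub>A\<^esub> A.e \<gamma>))"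
    unfolding hom_coordinates[OF \<phi> translate_closed(2)[OF a f]]
    by (intro sum.cong refl) (simp add: right_translate_def A.e_closed)
  also have "\<dots> = (\<Sum>\<gamma>\<in>B. \<Sum>\<beta>\<in>B. f (A.e \<beta>) * (matrix \<phi> (\<alpha>, \<gamma>) * h (a \<otimes>\<^bsub>A\<^esub> A.e \<gamma>) \<beta>))"
    using f a by (intro sum.cong refl)
      (subst dual_expansion, auto simp: mult_closed A.e_closed sum_distrib_left mult_ac)
  also have "\<dots> = (\<Sum>\<beta>\<in>B. f (A.e \<beta>) * (\<Sum>\<gamma>\<in>B. matrix \<phi> (\<alpha>, \<gamma>) * h (a \<otimes>\<^bsub>A\<^esub> A.e \<gamma>) \<beta>))"
    by (subst sum.swap) (simp add: sum_distrib_left)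
  also have "\<dots> = (\<Sum>\<beta>\<in>B. f (A.e \<beta>) * (\<Sum>(r, q)\<in>splits \<beta>. h a r * matrix \<phi> (\<alpha>, q)))"
  proof (intro sum.cong refl arg_cong2[where f = "(*)"])
    fix \<beta> assume \<beta>: "\<beta> \<in> B"
    have "(\<Sum>\<gamma>\<in>B. matrix \<phi> (\<alpha>, \<gamma>) * h (a \<otimes>\<^bsub>A\<^esub> A.e \<gamma>) \<beta>) =
        (\<Sum>\<gamma>\<in>B. \<Sum>x\<in>splits \<beta>. if snd x = \<gamma> then h a (fst x) * matrix \<phi> (\<alpha>, \<gamma>) else 0)"
      using a \<beta> by (intro sum.cong refl)
        (simp add: mult_e_left sum_distrib_left split_def if_distrib mult.commute cong: if_cong)
    also have "\<dots> = (\<Sum>x\<in>splits \<beta>. \<Sum>\<gamma>\<in>B. if snd x = \<gamma> then h a (fst x) * matrix \<phi> (\<alpha>, \<gamma>) else 0)"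
      by (rule sum.swap)
    also have "\<dots> = (\<Sum>(r, q)\<in>splits \<beta>. h a r * matrix \<phi> (\<alpha>, q))"
      using \<beta> A.finite_index by (intro sum.cong refl) (auto simp: sum.delta' dest: B_splits)
    finally show "(\<Sum>\<gamma>\<in>B. matrix \<phi> (\<alpha>, \<gamma>) * h (a \<otimes>\<^bsub>A\<^esub> A.e \<gamma>) \<beta>) =
      (\<Sum>(r, q)\<in>splits \<beta>. h a r * matrix \<phi> (\<alpha>, q))" .
  qed
  finally show ?thesis .
qed

lemma right_mult_coord:
  assumes \<phi>: "\<phi> \<in> carrier (hom_space (dual A) A)" and f: "f \<in> carrier (dual A)"
    and a: "a \<in> carrier A" and \<alpha>: "\<alpha> \<in> B"
  shows "h (\<phi> f \<otimes>\<^bsub>A\<^esub> a) \<alpha> =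
    (\<Sum>\<beta>\<in>B. f (A.e \<beta>) * (\<Sum>(q, r)\<in>splits \<alpha>. matrix \<phi> (q, \<beta>) * h a r))"
proof -
  have "h (\<phi> f \<otimes>\<^bsub>A\<^esub> a) \<alpha> = (\<Sum>x\<in>splits \<alpha>. \<Sum>\<beta>\<in>B. f (A.e \<beta>) * (matrix \<phi> (fst x, \<beta>) * h a (snd x)))"
    using assms by (simp add: mult hom_closed hom_coordinates sum_distrib_left split_def mult_ac)
  also have "\<dots> = (\<Sum>\<beta>\<in>B. f (A.e \<beta>) * (\<Sum>(q, r)\<in>splits \<alpha>. matrix \<phi> (q, \<beta>) * h a r))"
    by (subst sum.swap) (simp add: sum_distrib_left split_def)
  finally show ?thesis .
qed

lemma coord_eq_iff:
  assumes "x \<in> carrier A" "y \<in> carrier A"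
  shows "x = y \<longleftrightarrow> (\<forall>\<alpha>\<in>B. h x \<alpha> = h y \<alpha>)"
proof
  assume "\<forall>\<alpha>\<in>B. h x \<alpha> = h y \<alpha>"
  then have "h x \<alpha> = h y \<alpha>" for \<alpha>
    using assms A.outside by (cases "\<alpha> \<in> B") simp_all
  with assms show "x = y" by (intro A.eqI)
qed simp

text \<open>Comparison of coefficients: the member of the dual basis that belongs to \<beta>
  isolates the coefficient at \<beta>.\<close>

lemma sum_dual_eq_iff:
  fixes F G :: "_ \<Rightarrow> 'k"
  shows "(\<forall>f\<in>carrier (dual A). (\<Sum>\<beta>\<in>B. f (A.e \<beta>) * F \<beta>) = (\<Sum>\<beta>\<in>B. f (A.e \<beta>) * G \<beta>)) \<longleftrightarrow>
    (\<forall>\<beta>\<in>B. F \<beta> = G \<beta>)"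
proof (intro iffI ballI)
  fix \<beta> assume eq: "\<forall>f\<in>carrier (dual A). (\<Sum>\<beta>\<in>B. f (A.e \<beta>) * F \<beta>) = (\<Sum>\<beta>\<in>B. f (A.e \<beta>) * G \<beta>)"
    and \<beta>: "\<beta> \<in> B"
  have eval: "(\<Sum>\<gamma>\<in>B. D.e \<beta> (A.e \<gamma>) * K \<gamma>) = K \<beta>" for K :: "_ \<Rightarrow> 'k"
  proof -
    have "(\<Sum>\<gamma>\<in>B. D.e \<beta> (A.e \<gamma>) * K \<gamma>) = (\<Sum>\<gamma>\<in>B. if \<gamma> = \<beta> then K \<gamma> else 0)"
      using \<beta> by (intro sum.cong) (auto simp: dual_e)
    with \<beta> A.finite_index show ?thesis by (simp add: sum.delta)
  qed
  from bspec[OF eq D.e_closed[OF \<beta>]] show "F \<beta> = G \<beta>" by (simp only: eval)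
qed simp

lemma left_linear_iff:
  assumes \<phi>: "\<phi> \<in> carrier (hom_space (dual A) A)"
  shows "(\<forall>a\<in>carrier A. \<forall>f\<in>carrier (dual A). \<phi> (left_translate a f) = a \<otimes>\<^bsub>A\<^esub> \<phi> f) \<longleftrightarrow>
    left_balanced (matrix \<phi>)" (is "?L \<longleftrightarrow> _")
proof -
  have "?L \<longleftrightarrow> (\<forall>a\<in>carrier A. \<forall>\<alpha>\<in>B. \<forall>f\<in>carrier (dual A).
      h (\<phi> (left_translate a f)) \<alpha> = h (a \<otimes>\<^bsub>A\<^esub> \<phi> f) \<alpha>)"
    using \<phi> by (auto simp: coord_eq_iff hom_closed translate_closed mult_closed)
  also have "\<dots> \<longleftrightarrow> (\<forall>a\<in>carrier A. \<forall>\<alpha>\<in>B. \<forall>\<beta>\<in>B.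
      (\<Sum>(q, r)\<in>splits \<beta>. matrix \<phi> (\<alpha>, q) * h a r) = (\<Sum>(r, q)\<in>splits \<alpha>. h a r * matrix \<phi> (q, \<beta>)))"
    by (simp add: left_translate_coord[OF \<phi>] left_mult_coord[OF \<phi>] sum_dual_eq_iff)
  also have "\<dots> \<longleftrightarrow> left_balanced (matrix \<phi>)"
    unfolding left_balanced_def
  proof (intro iffI ballI allI)
    fix \<alpha> \<beta> c
    assume eq: "\<forall>a\<in>carrier A. \<forall>\<alpha>\<in>B. \<forall>\<beta>\<in>B.
      (\<Sum>(q, r)\<in>splits \<beta>. matrix \<phi> (\<alpha>, q) * h a r) = (\<Sum>(r, q)\<in>splits \<alpha>. h a r * matrix \<phi> (q, \<beta>))"
      and \<alpha>: "\<alpha> \<in> B" and \<beta>: "\<beta> \<in> B"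
    \<comment> \<open>The function c is arbitrary and need not vanish off B. Truncating it gives the
      coordinates of an element of A and changes neither sum, since factors of paths in B lie in
      B.\<close>
    let ?a = "A.vec (\<lambda>p. if p \<in> B then c p else 0)"
    have a: "?a \<in> carrier A" "h ?a = (\<lambda>p. if p \<in> B then c p else 0)"
      by (rule A.vec; simp)+
    have "(\<Sum>(q, r)\<in>splits \<beta>. matrix \<phi> (\<alpha>, q) * c r) = (\<Sum>(q, r)\<in>splits \<beta>. matrix \<phi> (\<alpha>, q) * h ?a r)"
      using \<beta> by (intro sum.cong) (auto simp: a dest: B_splits)
    also have "\<dots> = (\<Sum>(r, q)\<in>splits \<alpha>. h ?a r * matrix \<phi> (q, \<beta>))"
      using eq a \<alpha> \<beta> by blast
    also have "\<dots> = (\<Sum>(r, q)\<in>splits \<alpha>. c r * matrix \<phi> (q, \<beta>))"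
      using \<alpha> by (intro sum.cong) (auto simp: a dest: B_splits)
    finally show "(\<Sum>(q, r)\<in>splits \<beta>. matrix \<phi> (\<alpha>, q) * c r) = (\<Sum>(r, q)\<in>splits \<alpha>. c r * matrix \<phi> (q, \<beta>))" .
  qed blast
  finally show ?thesis .
qed

text \<open>Transposing the matrix interchanges \<alpha> and \<beta> and with them the two sides of
  the balance equation, which is how the right action is reduced to the same predicate as the left
  one.\<close>

lemma right_linear_iff:
  assumes \<phi>: "\<phi> \<in> carrier (hom_space (dual A) A)"
  shows "(\<forall>a\<in>carrier A. \<forall>f\<in>carrier (dual A). \<phi> (right_translate a f) = \<phi> f \<otimes>\<^bsub>A\<^esub> a) \<longleftrightarrow>
    left_balanced (\<lambda>(\<alpha>, \<beta>). matrix \<phi> (\<beta>, \<alpha>))" (is "?L \<longleftrightarrow> _")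
proof -
  have "?L \<longleftrightarrow> (\<forall>a\<in>carrier A. \<forall>\<alpha>\<in>B. \<forall>f\<in>carrier (dual A).
      h (\<phi> (right_translate a f)) \<alpha> = h (\<phi> f \<otimes>\<^bsub>A\<^esub> a) \<alpha>)"
    using \<phi> by (auto simp: coord_eq_iff hom_closed translate_closed mult_closed)
  also have "\<dots> \<longleftrightarrow> (\<forall>a\<in>carrier A. \<forall>\<alpha>\<in>B. \<forall>\<beta>\<in>B.
      (\<Sum>(r, q)\<in>splits \<beta>. h a r * matrix \<phi> (\<alpha>, q)) = (\<Sum>(q, r)\<in>splits \<alpha>. matrix \<phi> (q, \<beta>) * h a r))"
    by (simp add: right_translate_coord[OF \<phi>] right_mult_coord[OF \<phi>] sum_dual_eq_iff)
  also have "\<dots> \<longleftrightarrow> left_balanced (\<lambda>(\<alpha>, \<beta>). matrix \<phi> (\<beta>, \<alpha>))"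
    unfolding left_balanced_def prod.case
  proof (intro iffI ballI allI)
    fix \<alpha> \<beta> c
    assume eq: "\<forall>a\<in>carrier A. \<forall>\<alpha>\<in>B. \<forall>\<beta>\<in>B.
      (\<Sum>(r, q)\<in>splits \<beta>. h a r * matrix \<phi> (\<alpha>, q)) = (\<Sum>(q, r)\<in>splits \<alpha>. matrix \<phi> (q, \<beta>) * h a r)"
      and \<alpha>: "\<alpha> \<in> B" and \<beta>: "\<beta> \<in> B"
    let ?a = "A.vec (\<lambda>p. if p \<in> B then c p else 0)"
    have a: "?a \<in> carrier A" "h ?a = (\<lambda>p. if p \<in> B then c p else 0)"
      by (rule A.vec; simp)+
    have "(\<Sum>(q, r)\<in>splits \<beta>. matrix \<phi> (q, \<alpha>) * c r) = (\<Sum>(q, r)\<in>splits \<beta>. matrix \<phi> (q, \<alpha>) * h ?a r)"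
      using \<beta> by (intro sum.cong) (auto simp: a dest: B_splits)
    also have "\<dots> = (\<Sum>(r, q)\<in>splits \<alpha>. h ?a r * matrix \<phi> (\<beta>, q))"
      by (rule eq[rule_format, OF a(1) \<beta> \<alpha>, symmetric])
    also have "\<dots> = (\<Sum>(r, q)\<in>splits \<alpha>. c r * matrix \<phi> (\<beta>, q))"
      using \<alpha> by (intro sum.cong) (auto simp: a dest: B_splits)
    finally show "(\<Sum>(q, r)\<in>splits \<beta>. matrix \<phi> (q, \<alpha>) * c r) = (\<Sum>(r, q)\<in>splits \<alpha>. c r * matrix \<phi> (\<beta>, q))" .
  next
    fix a \<alpha> \<beta>
    assume eq: "\<forall>\<alpha>\<in>B. \<forall>\<beta>\<in>B. \<forall>c.
      (\<Sum>(q, r)\<in>splits \<beta>. matrix \<phi> (q, \<alpha>) * c r) = (\<Sum>(r, q)\<in>splits \<alpha>. c r * matrix \<phi> (\<beta>, q))"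
      and "\<alpha> \<in> B" "\<beta> \<in> B"
    then show "(\<Sum>(r, q)\<in>splits \<beta>. h a r * matrix \<phi> (\<alpha>, q)) = (\<Sum>(q, r)\<in>splits \<alpha>. matrix \<phi> (q, \<beta>) * h a r)"
      by (intro eq[rule_format, symmetric])
  qed
  finally show ?thesis .
qed

lemma bimodule_homs_matrix:
  "\<phi> \<in> bimodule_homs A \<longleftrightarrow> \<phi> \<in> carrier (hom_space (dual A) A) \<and> neat_invariant (matrix \<phi>)"
proof (cases "\<phi> \<in> carrier (hom_space (dual A) A)")
  case True
  then show ?thesis
    by (simp only: bimodule_homs_iff left_linear_iff right_linear_iff neat_invariant_iff[of "matrix \<phi>", OF matrix_support[OF True]])
qed (simp add: bimodule_homs_iff)

text \<open>The evaluation map is injective because functionals separate the elements of A. So its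
  inverse at f o \<phi> is known once a preimage is exhibited, and the vector \<open>?y\<close>
  obtained from f by the transposed matrix is one.\<close>

lemma dual_transpose_coord:
  assumes \<phi>: "\<phi> \<in> carrier (hom_space (dual A) A)" and f: "f \<in> carrier (dual A)"
  shows "dual_transpose A \<phi> f \<in> carrier A"
    and "h (dual_transpose A \<phi> f) \<beta> = (\<Sum>\<alpha>\<in>B. matrix \<phi> (\<alpha>, \<beta>) * f (A.e \<alpha>))"
proof -
  let ?y = "A.vec (\<lambda>\<beta>. \<Sum>\<alpha>\<in>B. matrix \<phi> (\<alpha>, \<beta>) * f (A.e \<alpha>))"
  have y: "?y \<in> carrier A" "h ?y = (\<lambda>\<beta>. \<Sum>\<alpha>\<in>B. matrix \<phi> (\<alpha>, \<beta>) * f (A.e \<alpha>))"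
    by (rule A.vec; simp add: matrix_support[OF \<phi>])+
  have "inj_on (evaluation A) (carrier A)"
  proof (rule inj_onI)
    fix x x' assume x: "x \<in> carrier A" "x' \<in> carrier A" and eq: "evaluation A x = evaluation A x'"
    have "g x = g x'" if "g \<in> carrier (dual A)" for g
      using fun_cong[OF eq, of g] that by (simp add: evaluation_def)
    then have "\<forall>g\<in>carrier (dual A). (\<Sum>\<beta>\<in>B. g (A.e \<beta>) * h x \<beta>) = (\<Sum>\<beta>\<in>B. g (A.e \<beta>) * h x' \<beta>)"
      using x dual_expansion by metis
    then show "x = x'" using x by (simp add: sum_dual_eq_iff coord_eq_iff)
  qed
  moreover have "(\<lambda>g\<in>carrier (dual A). f (\<phi> g)) = evaluation A ?y"
    unfolding evaluation_def
  proof (rule restrict_ext)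
    fix g assume g: "g \<in> carrier (dual A)"
    have "f (\<phi> g) = (\<Sum>\<alpha>\<in>B. \<Sum>\<beta>\<in>B. g (A.e \<beta>) * (matrix \<phi> (\<alpha>, \<beta>) * f (A.e \<alpha>)))"
      using \<phi> f g by (subst dual_expansion)
        (auto simp: hom_closed hom_coordinates sum_distrib_left mult_ac)
    also have "\<dots> = (\<Sum>\<beta>\<in>B. g (A.e \<beta>) * h ?y \<beta>)"
      by (subst sum.swap) (simp add: y sum_distrib_left)
    also have "\<dots> = g ?y" using dual_expansion[OF g y(1)] by simp
    finally show "f (\<phi> g) = g ?y" .
  qed
  ultimately have "dual_transpose A \<phi> f = ?y"
    using f y(1) by (simp add: dual_transpose_def inv_into_f_f)
  then show "dual_transpose A \<phi> f \<in> carrier A"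
    "h (dual_transpose A \<phi> f) \<beta> = (\<Sum>\<alpha>\<in>B. matrix \<phi> (\<alpha>, \<beta>) * f (A.e \<alpha>))"
    by (simp_all add: y)
qed

lemma transpose_condition:
  assumes \<phi>: "\<phi> \<in> carrier (hom_space (dual A) A)"
  shows "\<phi> \<oplus>\<^bsub>hom_space (dual A) A\<^esub> dual_transpose A \<phi> = \<zero>\<^bsub>hom_space (dual A) A\<^esub> \<longleftrightarrow>
    (\<forall>\<alpha> \<beta>. matrix \<phi> (\<alpha>, \<beta>) + matrix \<phi> (\<beta>, \<alpha>) = 0)"
proof -
  let ?M = "matrix \<phi>"
  have "\<phi> \<oplus>\<^bsub>hom_space (dual A) A\<^esub> dual_transpose A \<phi> = \<zero>\<^bsub>hom_space (dual A) A\<^esub> \<longleftrightarrow>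
      (\<forall>f\<in>carrier (dual A). \<phi> f \<oplus>\<^bsub>A\<^esub> dual_transpose A \<phi> f = \<zero>\<^bsub>A\<^esub>)"
    by (auto simp: hom_space_simps restrict_def fun_eq_iff)
  also have "\<dots> \<longleftrightarrow> (\<forall>f\<in>carrier (dual A). \<forall>\<alpha>\<in>B. h (\<phi> f) \<alpha> + h (dual_transpose A \<phi> f) \<alpha> = 0)"
    using \<phi> by (simp add: coord_eq_iff A.closed A.add A.zero hom_closed dual_transpose_coord(1))
  \<comment> \<open>The right-hand side 0 is written as a sum with zero coefficients so that
    coefficients can be compared as before.\<close>
  also have "\<dots> \<longleftrightarrow> (\<forall>\<alpha>\<in>B. \<forall>f\<in>carrier (dual A).
      (\<Sum>\<beta>\<in>B. f (A.e \<beta>) * (?M (\<alpha>, \<beta>) + ?M (\<beta>, \<alpha>))) = (\<Sum>\<beta>\<in>B. f (A.e \<beta>) * 0))"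
    using \<phi> by (auto simp: hom_coordinates dual_transpose_coord(2) sum.distrib algebra_simps)
  also have "\<dots> \<longleftrightarrow> (\<forall>\<alpha>\<in>B. \<forall>\<beta>\<in>B. ?M (\<alpha>, \<beta>) + ?M (\<beta>, \<alpha>) = 0)"
    by (simp only: sum_dual_eq_iff)
  also have "\<dots> \<longleftrightarrow> (\<forall>\<alpha> \<beta>. ?M (\<alpha>, \<beta>) + ?M (\<beta>, \<alpha>) = 0)"
    using matrix_support[OF \<phi>] by (metis add.right_neutral)
  finally show ?thesis .
qed

lemma Alt_carrier:
  "\<phi> \<in> carrier (Alt A) \<longleftrightarrow> \<phi> \<in> carrier (hom_space (dual A) A) \<and> neat_invariant (matrix \<phi>) \<and>
    (\<forall>\<alpha> \<beta>. matrix \<phi> (\<alpha>, \<beta>) + matrix \<phi> (\<beta>, \<alpha>) = 0)"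
  using transpose_condition by (auto simp: Alt_def bimodule_homs_matrix)

end

section \<open>Neat classes and the dimension of the alternating space\<close>

text \<open>T contains one member of each two-element orbit, so N is the disjoint union of the fixed
  points, T and the image of T.\<close>

lemma involution_transversal:
  assumes "finite N" and maps: "\<And>X. X \<in> N \<Longrightarrow> \<sigma> X \<in> N" and inv: "\<And>X. X \<in> N \<Longrightarrow> \<sigma> (\<sigma> X) = X"
  obtains T where "T \<subseteq> N" "\<And>X. X \<in> T \<Longrightarrow> \<sigma> X \<notin> T"
    "\<And>X. X \<in> N \<Longrightarrow> X \<notin> T \<Longrightarrow> \<sigma> X \<notin> T \<Longrightarrow> \<sigma> X = X"
    "card N = card {X \<in> N. \<sigma> X = X} + 2 * card T"
proof -
  \<comment> \<open>The choice depends only on the set {X, \<sigma> X}, which is the same for X and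
    \<sigma> X; so both members of an orbit choose the same representative.\<close>
  define c where "c X = (SOME Y. Y \<in> {X, \<sigma> X})" for X
  have c: "c X \<in> {X, \<sigma> X}" for X
    unfolding c_def by (rule someI[of _ X]) simp
  have c_\<sigma>: "c (\<sigma> X) = c X" if "X \<in> N" for X
    using inv[OF that] by (simp add: c_def insert_commute)
  define T where "T = {X \<in> N. \<sigma> X \<noteq> X \<and> c X = X}"
  let ?S = "{X \<in> N. \<sigma> X = X}"
  have sub: "T \<subseteq> N" by (auto simp: T_def)
  have disj: "\<sigma> X \<notin> T" if "X \<in> T" for X
    using that by (auto simp: T_def c_\<sigma>)
  have cover: "\<sigma> X = X" if "X \<in> N" "X \<notin> T" "\<sigma> X \<notin> T" for X
    using that c[of X] by (auto simp: T_def c_\<sigma> maps inv)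
  have N_eq: "N = ?S \<union> (T \<union> \<sigma> ` T)"
  proof (intro equalityI subsetI)
    fix X assume X: "X \<in> N"
    show "X \<in> ?S \<union> (T \<union> \<sigma> ` T)"
    proof (cases "\<sigma> X \<in> T")
      case True
      then have "X \<in> \<sigma> ` T" using inv[OF X] by (metis imageI)
      then show ?thesis by simp
    qed (use cover[OF X] X in blast)
  qed (use sub maps in auto)
  have finite: "finite T" "finite ?S" using \<open>finite N\<close> sub by (auto intro: finite_subset)
  have "inj_on \<sigma> T" using sub inv by (intro inj_on_inverseI[of _ \<sigma>]) auto
  then have "card (T \<union> \<sigma> ` T) = 2 * card T"
    using finite disj by (subst card_Un_disjoint) (auto simp: card_image)
  moreover have "?S \<inter> (T \<union> \<sigma> ` T) = {}"
    using sub inv by (auto simp: T_def)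
  ultimately have "card N = card ?S + 2 * card T"
    using finite by (subst N_eq, subst card_Un_disjoint) auto
  then show ?thesis using that sub disj cover by blast
qed

section \<open>Functions on equivalence classes of cyclic pairs\<close>

context monomial
begin

abbreviation E where
  "E \<equiv> cyclic_equiv Q Z"

lemma E_equiv: "equiv (cyclic_pairs Q Z) E"
  unfolding cyclic_equiv_def
  by (rule equivI) (auto simp: refl_on_def sym_def trans_def intro: equivclp_sym equivclp_trans)

text \<open>The flip preserves moves only up to reversal of their direction, which the symmetric
  closure absorbs.\<close>

lemma E_swap:
  assumes "(x, y) \<in> E"
  shows "(prod.swap x, prod.swap y) \<in> E"
proof -
  have "equivclp (move Q Z) x y" using assms by (simp add: cyclic_equiv_def)
  then have "equivclp (move Q Z) (prod.swap x) (prod.swap y)"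
  proof (induction rule: equivclp_induct)
    case (step y z)
    from step.hyps(2) have "equivclp (move Q Z) (prod.swap y) (prod.swap z)"
      by (auto dest: move_swap intro: equivclp_sym r_into_equivclp)
    with step.IH show ?case by (rule equivclp_trans)
  qed simp
  with assms show ?thesis
    by (cases x; cases y) (auto simp: cyclic_equiv_def cyclic_pairs_swap)
qed

lemma class_swap:
  assumes "x \<in> cyclic_pairs Q Z"
  shows "prod.swap ` (E `` {x}) = E `` {prod.swap x}"
proof (intro equalityI subsetI)
  fix y assume "y \<in> E `` {prod.swap x}"
  then have "prod.swap y \<in> E `` {x}" using E_swap[of "prod.swap x" y] by simp
  then show "y \<in> prod.swap ` (E `` {x})" by (intro image_eqI[of _ _ "prod.swap y"]) simp_all
qed (auto dest: E_swap)

lemma neat_classes_class: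
  assumes "X \<in> neat_classes Q Z"
  obtains x where "x \<in> cyclic_pairs Q Z" "X = E `` {x}"
  using assms unfolding neat_classes_def quotient_def by blast

lemma neat_classes_swap:
  assumes "X \<in> neat_classes Q Z"
  shows "prod.swap ` X \<in> neat_classes Q Z"
proof -
  obtain x where x: "x \<in> cyclic_pairs Q Z" "X = E `` {x}" using neat_classes_class[OF assms] .
  have "prod.swap x \<in> cyclic_pairs Q Z" using x by (cases x) (simp add: cyclic_pairs_swap)
  then have "prod.swap ` X \<in> cyclic_pairs Q Z // E"
    unfolding x(2) class_swap[OF x(1)] by (rule quotientI)
  moreover have "\<forall>x\<in>prod.swap ` X. neat Q Z x"
    using assms by (auto simp: neat_classes_def neat_swap)
  ultimately show ?thesis by (simp add: neat_classes_def)
qed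

lemma neat_invariant_class:
  assumes "neat_invariant M" "(x, y) \<in> E"
  shows "M x = M y"
proof -
  have "equivclp (move Q Z) x y" using assms by (simp add: cyclic_equiv_def)
  then show ?thesis
    using assms(1) by (induction rule: equivclp_induct) (auto simp: neat_invariant_def)
qed

text \<open>Such a class contains a pair that is not neat, where M vanishes, and M is constant on
  the class.\<close>

lemma neat_invariant_not_neat_class:
  assumes "neat_invariant M" "x \<in> cyclic_pairs Q Z" "E `` {x} \<notin> neat_classes Q Z"
  shows "M x = 0"
proof -
  have "E `` {x} \<in> cyclic_pairs Q Z // E" using assms(2) by (rule quotientI)
  with assms(3) obtain y where y: "(x, y) \<in> E" "\<not> neat Q Z y"
    by (auto simp: neat_classes_def)
  then have "y \<in> cyclic_pairs Q Z" by (simp add: cyclic_equiv_def)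
  with y assms(1) have "M y = 0" by (simp add: neat_invariant_def)
  with neat_invariant_class[OF assms(1) y(1)] show ?thesis by simp
qed

text \<open>Values on neat classes can be prescribed freely, which later gives the surjectivity of
  the coordinates on alternating morphisms.\<close>

lemma neat_invariant_from_classes:
  "neat_invariant (\<lambda>x. if x \<in> cyclic_pairs Q Z \<and> E `` {x} \<in> neat_classes Q Z then G (E `` {x}) else 0)"
  (is "neat_invariant ?M")
  unfolding neat_invariant_def
proof (intro conjI allI impI ballI)
  fix x y assume move: "move Q Z x y"
  then have xy: "x \<in> cyclic_pairs Q Z" "y \<in> cyclic_pairs Q Z" by (auto elim: move.cases)
  with move have "(x, y) \<in> E" by (auto simp: cyclic_equiv_def)
  then have "E `` {x} = E `` {y}" by (rule equiv_class_eq[OF E_equiv])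
  with xy show "?M x = ?M y" by simp
next
  fix x assume x: "x \<in> cyclic_pairs Q Z" "\<not> neat Q Z x"
  then have "E `` {x} \<notin> neat_classes Q Z"
    using equiv_class_self[OF E_equiv, of x] by (auto simp: neat_classes_def)
  then show "?M x = 0" by simp
qed auto

lemma neat_invariant_zero: "neat_invariant (\<lambda>x. 0)"
  by (simp add: neat_invariant_def)

lemma neat_invariant_add: "neat_invariant M \<Longrightarrow> neat_invariant N \<Longrightarrow> neat_invariant (\<lambda>x. M x + N x)"
  unfolding neat_invariant_def by (metis add.right_neutral)

lemma neat_invariant_scale: "neat_invariant M \<Longrightarrow> neat_invariant (\<lambda>x. c * M x)"
  unfolding neat_invariant_def by (metis mult_zero_right)

end

section \<open>Coordinates on the space of alternating morphisms\<close>

context monomial_coordinates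
begin

lemma finite_neat_classes: "finite (neat_classes Q Z)"
proof -
  have "finite (cyclic_pairs Q Z)"
    by (rule finite_subset[of _ "B \<times> B"]) (auto simp: cyclic_pairs_def A.finite_index)
  then have "finite (cyclic_pairs Q Z // E)"
    by (rule finite_quotient) (auto simp: cyclic_equiv_def)
  then show ?thesis unfolding neat_classes_def by simp
qed

lemma Alt_simps:
  "\<zero>\<^bsub>Alt A\<^esub> = \<zero>\<^bsub>hom_space (dual A) A\<^esub>"
  "\<phi> \<oplus>\<^bsub>Alt A\<^esub> \<psi> = \<phi> \<oplus>\<^bsub>hom_space (dual A) A\<^esub> \<psi>"
  "c \<odot>\<^bsub>Alt A\<^esub> \<phi> = c \<odot>\<^bsub>hom_space (dual A) A\<^esub> \<phi>"
  by (simp_all add: Alt_def)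

text \<open>The value does not depend on the chosen representative when the matrix of \<phi> is
  constant on classes, as it is for alternating \<phi>.\<close>

definition class_coord where
  "class_coord I \<phi> X = (if X \<in> I then matrix \<phi> (SOME x. x \<in> X) else 0)"

text \<open>The conditions \<open>unique\<close> and \<open>cover\<close> say that I contains
  exactly one of X and its flip if they differ, and contains a symmetric X iff 2 = 0. In this form
  one argument covers both characteristics.\<close>

lemma Alt_coordinates:
  assumes I: "I \<subseteq> neat_classes Q Z"
    and unique: "\<And>X. X \<in> I \<Longrightarrow> prod.swap ` X \<in> I \<Longrightarrow> prod.swap ` X = X \<and> (2::'k) = 0"
    and cover: "\<And>X. X \<in> neat_classes Q Z \<Longrightarrow> X \<notin> I \<Longrightarrow> prod.swap ` X \<notin> I \<Longrightarrow>
      prod.swap ` X = X \<and> (2::'k) \<noteq> 0"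
  shows "coordinates (Alt A) (class_coord I) I"
proof -
  let ?H = "hom_space (dual A) A"
  let ?N = "neat_classes Q Z"
  have carrier: "\<phi> \<in> carrier (Alt A) \<longleftrightarrow> \<phi> \<in> carrier ?H \<and> neat_invariant (matrix \<phi>) \<and>
      (\<forall>x. matrix \<phi> x + matrix \<phi> (prod.swap x) = 0)" for \<phi>
    by (auto simp: Alt_carrier)
  have zero: "matrix \<zero>\<^bsub>?H\<^esub> = (\<lambda>x. 0)" using H.zero by auto
  have add: "matrix (\<phi> \<oplus>\<^bsub>?H\<^esub> \<psi>) = (\<lambda>x. matrix \<phi> x + matrix \<psi> x)"
    if "\<phi> \<in> carrier ?H" "\<psi> \<in> carrier ?H" for \<phi> \<psi> using H.add[OF that] by auto
  have smult: "matrix (c \<odot>\<^bsub>?H\<^esub> \<phi>) = (\<lambda>x. c * matrix \<phi> x)"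
    if "\<phi> \<in> carrier ?H" for \<phi> c using H.smult[OF that] by auto
  have representative: "(x, SOME y. y \<in> E `` {x}) \<in> E" if "x \<in> cyclic_pairs Q Z" for x
    using someI[of "\<lambda>y. y \<in> E `` {x}" x] equiv_class_self[OF E_equiv that] by simp
  have class_value: "matrix \<phi> x = class_coord I \<phi> (E `` {x})"
    if "\<phi> \<in> carrier (Alt A)" "x \<in> cyclic_pairs Q Z" "E `` {x} \<in> I" for \<phi> x
    using that neat_invariant_class[OF _ representative, of "matrix \<phi>" x] by (simp add: carrier class_coord_def)
  show ?thesis
  proof (unfold_locales, unfold Alt_simps)
    show "\<zero>\<^bsub>?H\<^esub> \<in> carrier (Alt A)"
      by (simp add: carrier zero H.closed neat_invariant_zero)
    show "class_coord I \<zero>\<^bsub>?H\<^esub> X = 0" for X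
      by (simp add: class_coord_def zero)
  next
    fix \<phi> \<psi> X assume \<phi>: "\<phi> \<in> carrier (Alt A)" and \<psi>: "\<psi> \<in> carrier (Alt A)"
    have "matrix \<phi> x + matrix \<psi> x + (matrix \<phi> (prod.swap x) + matrix \<psi> (prod.swap x)) = 0" for x
    proof -
      have "matrix \<phi> x + matrix \<phi> (prod.swap x) = 0" "matrix \<psi> x + matrix \<psi> (prod.swap x) = 0"
        using \<phi> \<psi> carrier by blast+
      then show ?thesis by (metis (no_types) add.assoc add.commute add.left_neutral)
    qed
    with \<phi> \<psi> show "\<phi> \<oplus>\<^bsub>?H\<^esub> \<psi> \<in> carrier (Alt A)"
      unfolding carrier by (simp add: add H.closed neat_invariant_add)
    show "class_coord I (\<phi> \<oplus>\<^bsub>?H\<^esub> \<psi>) X = class_coord I \<phi> X + class_coord I \<psi> X"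
      using \<phi> \<psi> by (simp add: carrier class_coord_def add)
  next
    fix \<phi> c X assume \<phi>: "\<phi> \<in> carrier (Alt A)"
    have "c * matrix \<phi> x + c * matrix \<phi> (prod.swap x) = 0" for x
      using \<phi> unfolding carrier by (metis distrib_left mult_zero_right)
    with \<phi> show "c \<odot>\<^bsub>?H\<^esub> \<phi> \<in> carrier (Alt A)"
      unfolding carrier by (simp add: smult H.closed neat_invariant_scale)
    show "class_coord I (c \<odot>\<^bsub>?H\<^esub> \<phi>) X = c * class_coord I \<phi> X"
      using \<phi> by (simp add: carrier class_coord_def smult)
  next
    show "inj_on (class_coord I) (carrier (Alt A))"
    proof (rule inj_onI)
      fix \<phi> \<psi> assume \<phi>: "\<phi> \<in> carrier (Alt A)" and \<psi>: "\<psi> \<in> carrier (Alt A)"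
        and eq: "class_coord I \<phi> = class_coord I \<psi>"
      have "matrix \<phi> x = matrix \<psi> x" for x
      proof (cases "x \<in> cyclic_pairs Q Z \<and> E `` {x} \<in> ?N")
        case False
        then have "matrix \<chi> x = 0" if "\<chi> \<in> carrier (Alt A)" for \<chi>
          using that neat_invariant_not_neat_class[of "matrix \<chi>" x] unfolding carrier neat_invariant_def by blast
        then show ?thesis using \<phi> \<psi> by simp
      next
        case True
        then have x: "x \<in> cyclic_pairs Q Z" "E `` {x} \<in> ?N" by auto
        have x': "prod.swap x \<in> cyclic_pairs Q Z" using x by (cases x) (simp add: cyclic_pairs_swap)
        have anti: "matrix \<chi> x = - matrix \<chi> (prod.swap x)" if "\<chi> \<in> carrier (Alt A)" for \<chi>
          using that unfolding carrier eq_neg_iff_add_eq_0 by blast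
        \<comment> \<open>The value at x is a coordinate, or the negative of a coordinate, or it is
          zero: on a symmetric class antisymmetry reads 2 M(x) = 0.\<close>
        consider "E `` {x} \<in> I" | "E `` {prod.swap x} \<in> I"
          | "E `` {prod.swap x} = E `` {x}" "(2::'k) \<noteq> 0"
          using cover[OF x(2)] class_swap[OF x(1)] by auto
        then show ?thesis
        proof cases
          case 1
          then show ?thesis using class_value[OF _ x(1)] \<phi> \<psi> eq by simp
        next
          case 2
          then show ?thesis using class_value[OF _ x'] anti \<phi> \<psi> eq by simp
        next
          case 3
          have "matrix \<chi> x = 0" if \<chi>: "\<chi> \<in> carrier (Alt A)" for \<chi>
          proof -
            have "(x, prod.swap x) \<in> E"
              using 3(1) x' by (metis E_equiv eq_equiv_class)
            then have eq_swap: "matrix \<chi> x = matrix \<chi> (prod.swap x)"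
              using \<chi> by (intro neat_invariant_class) (simp_all add: carrier)
            have "matrix \<chi> x + matrix \<chi> (prod.swap x) = 0" using \<chi> carrier by blast
            then have "2 * matrix \<chi> x = 0" by (simp only: eq_swap[symmetric] mult_2)
            with 3(2) show ?thesis by simp
          qed
          then show ?thesis using \<phi> \<psi> by simp
        qed
      qed
      then show "\<phi> = \<psi>" using \<phi> \<psi> by (intro H.eqI) (simp_all add: carrier)
    qed
  next
    show "finite I" using I finite_neat_classes by (rule finite_subset)
  next
    have "g \<in> class_coord I ` carrier (Alt A)" if g: "\<And>X. X \<notin> I \<Longrightarrow> g X = 0" for g
    proof -
      \<comment> \<open>The antisymmetric extension of g to all classes. The two branches overlap
        only if X and its flip both lie in I; then X is symmetric and 2 = 0, so the sign is
        irrelevant.\<close>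
      define G where "G X = (if X \<in> I then g X else if prod.swap ` X \<in> I then - g (prod.swap ` X) else 0)" for X
      define M where "M x = (if x \<in> cyclic_pairs Q Z \<and> E `` {x} \<in> ?N then G (E `` {x}) else 0)" for x
      let ?\<phi> = "H.vec M"
      have neat_invariant_M: "neat_invariant M" unfolding M_def by (rule neat_invariant_from_classes)
      have support: "M x = 0" if "x \<notin> B \<times> B" for x
        using that by (auto simp: M_def cyclic_pairs_def)
      have \<phi>: "?\<phi> \<in> carrier ?H" "matrix ?\<phi> = M"
        using H.vec[of M] support by blast+
      have G_swap: "G X + G (prod.swap ` X) = 0" for X
      proof -
        have inv: "prod.swap ` prod.swap ` X = X" by (simp add: image_comp)
        have "g X + g X = 0" if "X \<in> I" "prod.swap ` X \<in> I"
          using unique[OF that] by (metis mult_2 mult_zero_left)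
        then show ?thesis using unique[of X] by (auto simp: G_def inv)
      qed
      have "M x + M (prod.swap x) = 0" for x
      proof (cases "x \<in> cyclic_pairs Q Z")
        case True
        then have "prod.swap x \<in> cyclic_pairs Q Z" by (cases x) (simp add: cyclic_pairs_swap)
        moreover have "E `` {prod.swap x} \<in> ?N \<longleftrightarrow> E `` {x} \<in> ?N"
          using neat_classes_swap[of "E `` {x}"] neat_classes_swap[of "E `` {prod.swap x}"]
            class_swap[OF True] class_swap[OF calculation] by auto
        ultimately show ?thesis
          using True G_swap[of "E `` {x}"] class_swap[OF True] by (simp add: M_def)
      next
        case False
        then have "prod.swap x \<notin> cyclic_pairs Q Z" by (cases x) (simp add: cyclic_pairs_swap)
        with False show ?thesis by (simp add: M_def)
      qed
      then have Alt: "?\<phi> \<in> carrier (Alt A)" using \<phi> neat_invariant_M by (simp add: carrier)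
      have "class_coord I ?\<phi> X = g X" for X
      proof (cases "X \<in> I")
        case True
        with I obtain x where x: "x \<in> cyclic_pairs Q Z" "X = E `` {x}"
          using neat_classes_class by blast
        with True I have "class_coord I ?\<phi> X = M x"
          using class_value[OF Alt x(1)] \<phi> by simp
        also have "\<dots> = g X" using x True I by (auto simp: M_def G_def)
        finally show ?thesis .
      qed (simp add: class_coord_def g)
      with Alt show ?thesis by (intro image_eqI[of _ _ ?\<phi>]) auto
    qed
    then show "class_coord I ` carrier (Alt A) = {f. \<forall>X. X \<notin> I \<longrightarrow> f X = 0}"
      by (auto simp: class_coord_def)
  qed
qed

end

theorem theorem4p6:
  fixes Q :: "('v, 'e) pre_digraph"
    and Z :: "('v, 'e) qpath set"
    and A :: "('k::field, (('v, 'e) qpath \<Rightarrow> 'k) set) module"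
    and r s :: nat
  assumes "fin_digraph Q"
    and "Digraph_Component.connected Q"
    and "minimal_relations Q Z"
    and "A = monomial_algebra Q Z"
    and "vectorspace.fin_dim class_ring A"
    and "r = card (neat_classes Q Z)"
    and "s = card (symmetric_neat_classes Q Z)"
  shows "vectorspace class_ring (Alt A) \<and> vectorspace.fin_dim class_ring (Alt A) \<and>
    real (vectorspace.dim class_ring (Alt A)) =
      (if CHAR('k) = 2 then (real r + real s) / 2 else (real r - real s) / 2)"
proof -
  interpret monomial Q Z
    using assms(1,3) by (intro monomial.intro monomial_axioms.intro)
  note facts = monomial_algebra_facts[where 'k = 'k, folded assms(4)]
  interpret A: coordinates A coset_coord B
    using monomial_algebra_coordinates assms(4,5) by blast
  interpret monomial_coordinates Q Z A coset_coord
    by (intro monomial_coordinates.intro monomial_coordinates_axioms.intro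
        monomial_axioms A.coordinates_axioms facts(2,3))
  let ?N = "neat_classes Q Z"
  let ?S = "{X \<in> ?N. prod.swap ` X = X}"
  obtain T where T: "T \<subseteq> ?N" "\<And>X. X \<in> T \<Longrightarrow> prod.swap ` X \<notin> T"
    "\<And>X. X \<in> ?N \<Longrightarrow> X \<notin> T \<Longrightarrow> prod.swap ` X \<notin> T \<Longrightarrow> prod.swap ` X = X"
    "card ?N = card ?S + 2 * card T"
    by (rule involution_transversal[OF finite_neat_classes, of "\<lambda>X. prod.swap ` X"])
      (auto simp: neat_classes_swap image_comp)
  have r: "real r = real s + 2 * real (card T)"
    using T(4) assms(6,7) by (simp add: symmetric_neat_classes_def)
  \<comment> \<open>The only divisors of 2 are 1 and 2, and 1 is not the characteristic of a
    field.\<close>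
  have "CHAR('k) dvd 2 \<longleftrightarrow> CHAR('k) = 2"
    using two_is_prime_nat CHAR_not_1[where 'a = 'k] by (auto simp: prime_nat_iff)
  then have char: "CHAR('k) = 2 \<longleftrightarrow> (2::'k) = 0"
    using of_nat_eq_0_iff_char_dvd[of 2, where 'a = 'k] by simp
  \<comment> \<open>By the relation between r, s and T, the set T has (r - s)/2 elements. Adding the
    s symmetric classes when 2 = 0 gives (r + s)/2.\<close>
  define I where "I = (if (2::'k) = 0 then T \<union> ?S else T)"
  interpret Alt: coordinates "Alt A" "class_coord I" I
  proof (rule Alt_coordinates)
    show "I \<subseteq> ?N" using T(1) by (auto simp: I_def)
  next
    fix X assume "X \<in> I" "prod.swap ` X \<in> I"
    moreover have "prod.swap ` prod.swap ` X = X" by (simp add: image_comp)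
    ultimately show "prod.swap ` X = X \<and> (2::'k) = 0"
      using T(2)[of X] by (auto simp: I_def split: if_splits)
  next
    fix X assume "X \<in> ?N" "X \<notin> I" "prod.swap ` X \<notin> I"
    then show "prod.swap ` X = X \<and> (2::'k) \<noteq> 0"
      using T(3)[of X] by (auto simp: I_def split: if_splits)
  qed
  have "T \<inter> ?S = {}" using T(2) by force
  then have "card I = (if (2::'k) = 0 then card T + s else card T)"
    using finite_neat_classes T(1) finite_subset[OF T(1) finite_neat_classes] assms(7)
    by (simp add: I_def card_Un_disjoint symmetric_neat_classes_def)
  with r show ?thesis
    using Alt.is_vectorspace Alt.fin_dim Alt.dim by (simp add: char)
qed

end
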